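(* Let $q>2$ be a prime power and $n\ge 3$. Let $\Omega$ be the set of points of the elliptic quadric $\mathsf{Q}^-(2n-1,q)$ not contained in a fixed hyperplane $\Pi$ whose section with the quadric is nondegenerate, and let $\sigma:\Omega\to\Omega$ be as in the context. Define relations on $\Omega$: $R_0=\{(X,Y):X=Y\}$, $R_1=\{(X,Y):Y\not\sim X\text{ and }X\sim Y^\sigma\}$, $R_2=\{(X,Y):Y\not\sim X\text{ and }X\not\sim Y^\sigma\}$, $R_3=\{(X,Y):Y\sim X\text{ and }X\not\sim Y^\sigma\}$, $R_4=\{(X,Y):X=Y^\sigma\}$. Then $(\Omega,\{R_0,\dots,R_4\})$ is an association scheme, and its minimal idempotents can be ordered $E_0,\dots,E_4$ so that its matrix of eigenvalues is \[ \begin{bmatrix} 1 & ( q^{n-2}-1)(q^{n-1}+1) & q^{n-2} ( q-2) (q^{n-1}+1) & ( q^{n-2}-1)(q^{n-1}+1) & 1\\ 1 & {q}^{n-1}+1 & 0 & -( {q}^{n-1}+1) & -1\\ 1 & q^{n-2}-1 & -2q^{n-2} & q^{n-2}-1 & 1\\ 1 & -( q^{n-2}-1) & 0 & q^{n-2}-1 & -1\\ 1 &-q^{n - 2}(q - 2)-1& 2q^{n-2}( q-2) & -q^{n - 2}(q - 2)-1& 1 \end{bmatrix}. \]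
   Context: Let $\perp$ be the polarity of $\mathsf{PG}(2n-1,q)$ associated with the quadric $\mathsf{Q}^-(2n-1,q)$ and $\Pi^\perp$ the pole of $\Pi$ (a point not on the quadric). For $P\in\Omega$, the line through $P$ and $\Pi^\perp$ meets the quadric in exactly two points, both outside $\Pi$; $\sigma(P)=P^\sigma$ is the one different from $P$ (so $\sigma$ is an involution of $\Omega$). For points $X,Y$, $X\sim Y$ means $X\ne Y$ and $X,Y$ are collinear in the quadric (the line $XY$ lies on the quadric). The matrix of eigenvalues has entry in row $i$, column $\ell$ equal to the eigenvalue of the adjacency matrix of $R_\ell$ on the column space of $E_i$; $E_0=\frac{1}{|\Omega|}J$. Note $|\Omega|=q^{n-1}(q^{n-1}-1)$.
   Formalization: In R_2 the conditions X ≠ Y and X ≠ Y^σ are added: since ∼ is irreflexive and X is never collinear with X^σ in the quadric, R_2 as written would contain R_0 and R_4, and the relations would not partition Ω×Ω. *)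

theory Defs
  imports "HOL-Analysis.Analysis"
begin

text \<open>
  \<open>PG(2n-1,q)\<close> is the projective space of \<open>'a ^ 'd\<close>, where \<open>'a\<close> is a field with \<open>q\<close> elements and
  \<open>CARD('d) = 2 * n\<close>: its points are the subspaces of vector space dimension 1, and the line
  through two points is the span of their union.
\<close>

definition polar_form :: "('a::field ^ 'd \<Rightarrow> 'a) \<Rightarrow> 'a ^ 'd \<Rightarrow> 'a ^ 'd \<Rightarrow> 'a" where
  "polar_form Q x y = Q (x + y) - Q x - Q y"

text \<open>The polar form is symmetric, so linearity in the first argument gives bilinearity.\<close>

definition quadratic_form :: "('a::field ^ 'd \<Rightarrow> 'a) \<Rightarrow> bool" where
  "quadratic_form Q \<longleftrightarrow>
     (\<forall>c x. Q (c *s x) = c\<^sup>2 * Q x) \<and>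
     (\<forall>x y z. polar_form Q (x + y) z = polar_form Q x z + polar_form Q y z) \<and>
     (\<forall>c x z. polar_form Q (c *s x) z = c * polar_form Q x z)"

text \<open>
  The condition \<open>Q v = 0\<close> is needed in characteristic 2: a form on an odd-dimensional space then
  has a nonzero radical (the nucleus), although its quadric may be nondegenerate.
\<close>

definition nondegenerate_on :: "('a::field ^ 'd \<Rightarrow> 'a) \<Rightarrow> ('a ^ 'd) set \<Rightarrow> bool" where
  "nondegenerate_on Q W \<longleftrightarrow>
     (\<forall>v\<in>W. Q v = 0 \<and> (\<forall>w\<in>W. polar_form Q v w = 0) \<longrightarrow> v = 0)"

definition totally_singular :: "('a::field ^ 'd \<Rightarrow> 'a) \<Rightarrow> ('a ^ 'd) set \<Rightarrow> bool" where
  "totally_singular Q U \<longleftrightarrow> (\<forall>u\<in>U. Q u = 0)"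

definition witt_index :: "('a::field ^ 'd \<Rightarrow> 'a) \<Rightarrow> nat" where
  "witt_index Q = Max {vec.dim U | U. vec.subspace U \<and> totally_singular Q U}"

text \<open>
  A nondegenerate form in \<open>2n\<close> variables over a finite field has Witt index \<open>n\<close> (hyperbolic) or
  \<open>n - 1\<close> (elliptic).
\<close>

definition elliptic_form :: "nat \<Rightarrow> ('a::field ^ 'd \<Rightarrow> 'a) \<Rightarrow> bool" where
  "elliptic_form n Q \<longleftrightarrow>
     CARD('d) = 2 * n \<and> quadratic_form Q \<and> nondegenerate_on Q UNIV \<and> witt_index Q = n - 1"

definition quadric_points :: "('a::field ^ 'd \<Rightarrow> 'a) \<Rightarrow> ('a ^ 'd) set set" where
  "quadric_points Q = {X. vec.subspace X \<and> vec.dim X = 1 \<and> totally_singular Q X}"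

definition hyperplane :: "('a::field ^ 'd) set \<Rightarrow> bool" where
  "hyperplane H \<longleftrightarrow> vec.subspace H \<and> vec.dim H = CARD('d) - 1"

definition polarity :: "('a::field ^ 'd \<Rightarrow> 'a) \<Rightarrow> ('a ^ 'd) set \<Rightarrow> ('a ^ 'd) set" where
  "polarity Q U = {v. \<forall>u\<in>U. polar_form Q v u = 0}"

definition quadric_adj :: "('a::field ^ 'd \<Rightarrow> 'a) \<Rightarrow> ('a ^ 'd) set \<Rightarrow> ('a ^ 'd) set \<Rightarrow> bool" where
  "quadric_adj Q X Y \<longleftrightarrow> X \<noteq> Y \<and> totally_singular Q (vec.span (X \<union> Y))"

definition Omega :: "('a::field ^ 'd \<Rightarrow> 'a) \<Rightarrow> ('a ^ 'd) set \<Rightarrow> ('a ^ 'd) set set" where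
  "Omega Q H = {X \<in> quadric_points Q. \<not> X \<subseteq> H}"

definition sigma_inv :: "('a::field ^ 'd \<Rightarrow> 'a) \<Rightarrow> ('a ^ 'd) set \<Rightarrow> ('a ^ 'd) set \<Rightarrow> ('a ^ 'd) set" where
  "sigma_inv Q H P =
     (THE P'. P' \<in> quadric_points Q \<and> P' \<subseteq> vec.span (P \<union> polarity Q H) \<and> P' \<noteq> P)"

text \<open>
  In the relation with index 2, \<open>X \<noteq> Y\<close> and \<open>X \<noteq> Y\<^sup>\<sigma>\<close> have to be required explicitly: adjacency is
  irreflexive, and no \<open>X\<close> is adjacent to \<open>X\<^sup>\<sigma>\<close>, so the two non-adjacencies alone also hold for all
  pairs in the relations with index 0 and 4.
\<close>

definition Omega_rel ::
  "('a::field ^ 'd \<Rightarrow> 'a) \<Rightarrow> ('a ^ 'd) set \<Rightarrow> nat \<Rightarrow> (('a ^ 'd) set \<times> ('a ^ 'd) set) set" where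
  "Omega_rel Q H i =
     {(X, Y). X \<in> Omega Q H \<and> Y \<in> Omega Q H \<and>
       [X = Y,
        \<not> quadric_adj Q Y X \<and> quadric_adj Q X (sigma_inv Q H Y),
        \<not> quadric_adj Q Y X \<and> \<not> quadric_adj Q X (sigma_inv Q H Y) \<and>
          X \<noteq> Y \<and> X \<noteq> sigma_inv Q H Y,
        quadric_adj Q Y X \<and> \<not> quadric_adj Q X (sigma_inv Q H Y),
        X = sigma_inv Q H Y] ! i}"

text \<open>Symmetric association schemes with \<open>d\<close> classes.\<close>

definition association_scheme :: "'p set \<Rightarrow> nat \<Rightarrow> (nat \<Rightarrow> ('p \<times> 'p) set) \<Rightarrow> bool" where
  "association_scheme X d R \<longleftrightarrow>
     finite X \<and> X \<noteq> {} \<and>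
     partition_on (X \<times> X) (R ` {..d}) \<and> inj_on R {..d} \<and>
     R 0 = Id_on X \<and>
     (\<forall>i\<le>d. sym (R i)) \<and>
     (\<exists>p :: nat \<Rightarrow> nat \<Rightarrow> nat \<Rightarrow> nat. \<forall>i\<le>d. \<forall>j\<le>d. \<forall>k\<le>d. \<forall>(x, y)\<in>R k.
        card {z \<in> X. (x, z) \<in> R i \<and> (z, y) \<in> R j} = p i j k)"

text \<open>
  Matrices with rows and columns indexed by a subset \<open>X\<close> of a finite type are represented as
  matrices over the whole type whose entries outside \<open>X \<times> X\<close> are zero.
\<close>

definition adj_matrix :: "('p::finite \<times> 'p) set \<Rightarrow> real ^ 'p ^ 'p" where
  "adj_matrix r = (\<chi> x y. if (x, y) \<in> r then 1 else 0)"

definition all_ones :: "'p::finite set \<Rightarrow> real ^ 'p ^ 'p" where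
  "all_ones X = (\<chi> x y. if x \<in> X \<and> y \<in> X then 1 else 0)"

definition bose_mesner :: "nat \<Rightarrow> (nat \<Rightarrow> ('p::finite \<times> 'p) set) \<Rightarrow> (real ^ 'p ^ 'p) set" where
  "bose_mesner d R = span ((\<lambda>i. adj_matrix (R i)) ` {..d})"

definition minimal_idempotents :: "(real ^ 'p::finite ^ 'p) set \<Rightarrow> (real ^ 'p ^ 'p) set" where
  "minimal_idempotents \<A> =
     {E \<in> \<A>. E \<noteq> 0 \<and> E ** E = E \<and>
        (\<forall>F\<in>\<A>. F ** F = F \<and> E ** F = F \<and> F ** E = F \<longrightarrow> F = 0 \<or> F = E)}"

text \<open>
  Row \<open>i\<close>, column \<open>l\<close> of the matrix of eigenvalues is the eigenvalue of the adjacency matrix of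
  \<open>R l\<close> on the column space of \<open>E i\<close>.
\<close>

definition eigenvalue_matrix ::
  "nat \<Rightarrow> (nat \<Rightarrow> ('p::finite \<times> 'p) set) \<Rightarrow> (nat \<Rightarrow> real ^ 'p ^ 'p) \<Rightarrow> (nat \<Rightarrow> nat \<Rightarrow> real) \<Rightarrow> bool"
  where
  "eigenvalue_matrix d R E P \<longleftrightarrow>
     (\<forall>i\<le>d. \<forall>l\<le>d. \<forall>v\<in>span (columns (E i)). adj_matrix (R l) *v v = P i l *\<^sub>R v)"

end

theory Submission
  imports Defs
begin

text \<open>
  Write \<open>B\<close> for the polar form, \<open>p\<close> for a vector spanning the pole of \<open>H\<close> and \<open>u = q^(n-2)\<close>. Each point of
  \<open>Omega\<close> has a unique representative \<open>x\<close> with \<open>Q x = 0\<close> and \<open>B x p = 1\<close>; in these coordinates the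
  involution is \<open>x \<mapsto> p / Q p - x\<close>, so adjacency of \<open>X\<close> to \<open>Y\<close> and to its image under the involution are the conditions
  \<open>B x y = 0\<close> and \<open>B x y = 1 / Q p\<close>. All numbers of common neighbours are therefore numbers of singular
  vectors in affine subspaces \<open>B z w\<^sub>i = a\<^sub>i\<close>. Averaging the number of solutions of
  \<open>Q z + (\<Sum>i. s\<^sub>i * (B z w\<^sub>i - a\<^sub>i)) = 0\<close> over \<open>s\<close>, and completing the square, reduces these to
  counting the zeros of the quadratic polynomial \<open>Q (\<Sum>i. s\<^sub>i w\<^sub>i) + (\<Sum>i. s\<^sub>i a\<^sub>i)\<close> in at most three variables;
  this needs only the number of solutions of \<open>Q z = c\<close>, which depends just on whether \<open>c = 0\<close>.

  With \<open>A\<close> the adjacency matrix of collinearity, \<open>T\<close> that of the involution and \<open>J\<close> the all-ones matrix,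
  the counts express \<open>A\<^sup>2\<close> in terms of \<open>I, T, A, A T, J\<close>, so these matrices span a commutative algebra.
  On the eigenspaces \<open>T = -1\<close> and \<open>T = 1\<close> (modulo \<open>J\<close>) the matrix \<open>A\<close> satisfies quadratic equations with roots
  \<open>u - 1\<close>, \<open>-(q u + 1)\<close> and \<open>u - 1\<close>, \<open>-u (q - 2) - 1\<close>, which gives the idempotents explicitly.
\<close>

section \<open>Association schemes from orthogonal idempotents\<close>

lemma adj_matrix_mult_nth:
  "(adj_matrix r ** adj_matrix s) $ x $ y = real (card {z. (x, z) \<in> r \<and> (z, y) \<in> s})"
proof -
  have "(adj_matrix r ** adj_matrix s) $ x $ y
      = (\<Sum>z\<in>UNIV. if (x, z) \<in> r \<and> (z, y) \<in> s then 1 else 0)"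
    by (simp add: matrix_matrix_mult_def adj_matrix_def if_distrib cong: if_cong)
      (rule sum.cong, auto)
  then show ?thesis
    by (simp flip: sum.inter_filter)
qed

text \<open>Equality of two fixed entries is a linear condition on \<open>M\<close>, and every
  generator satisfies it because distinct relations are disjoint.\<close>

lemma bose_mesner_constant_on_relations:
  fixes R :: "nat \<Rightarrow> ('p::finite \<times> 'p) set"
  assumes disj: "\<And>i j. i \<le> d \<Longrightarrow> j \<le> d \<Longrightarrow> i \<noteq> j \<Longrightarrow> R i \<inter> R j = {}"
    and M: "M \<in> bose_mesner d R" and "k \<le> d" and "(x, y) \<in> R k" and "(x', y') \<in> R k"
  shows "M $ x $ y = M $ x' $ y'"
  using M unfolding bose_mesner_def
proof (induction rule: span_induct)
  show "subspace {M. M $ x $ y = M $ x' $ y'}"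
    by (auto simp: subspace_def)
next
  fix M assume "M \<in> (\<lambda>i. adj_matrix (R i)) ` {..d}"
  then obtain i where "i \<le> d" and M: "M = adj_matrix (R i)" by auto
  then have "i = k \<or> R i \<inter> R k = {}" using disj[of i k] \<open>k \<le> d\<close> by blast
  then show "M $ x $ y = M $ x' $ y'"
    using assms(4,5) by (auto simp: M adj_matrix_def)
qed

text \<open>Closure of the span under products replaces explicit intersection numbers: the entries
  of \<open>adj_matrix (R i) ** adj_matrix (R j)\<close> are the required cardinalities, and they
  are constant on each relation.\<close>

lemma association_schemeI:
  fixes R :: "nat \<Rightarrow> ('p::finite \<times> 'p) set"
  assumes "X \<noteq> {}"
    and nonempty: "\<And>i. i \<le> d \<Longrightarrow> R i \<noteq> {}"
    and disj: "\<And>i j. i \<le> d \<Longrightarrow> j \<le> d \<Longrightarrow> i \<noteq> j \<Longrightarrow> R i \<inter> R j = {}"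
    and cover: "(\<Union>i\<le>d. R i) = X \<times> X"
    and "R 0 = Id_on X"
    and "\<And>i. i \<le> d \<Longrightarrow> sym (R i)"
    and closed: "\<And>i j. i \<le> d \<Longrightarrow> j \<le> d \<Longrightarrow> adj_matrix (R i) ** adj_matrix (R j) \<in> bose_mesner d R"
  shows "association_scheme X d R"
proof -
  have inj: "inj_on R {..d}"
    by (rule inj_onI) (metis disj nonempty atMost_iff inf.idem)
  have part: "partition_on (X \<times> X) (R ` {..d})"
    unfolding partition_on_def disjoint_def using cover nonempty disj by (auto; metis IntI empty_iff)
  have const: "\<exists>c. \<forall>(x, y)\<in>R k. card {z \<in> X. (x, z) \<in> R i \<and> (z, y) \<in> R j} = c"
    if "i \<le> d" "j \<le> d" "k \<le> d" for i j k
  proof -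
    obtain x0 y0 where k0: "(x0, y0) \<in> R k" using nonempty[OF \<open>k \<le> d\<close>] by auto
    have X: "{z \<in> X. (x, z) \<in> R i \<and> (z, y) \<in> R j} = {z. (x, z) \<in> R i \<and> (z, y) \<in> R j}" for x y
      using cover that by auto
    have "card {z \<in> X. (x, z) \<in> R i \<and> (z, y) \<in> R j} = card {z \<in> X. (x0, z) \<in> R i \<and> (z, y0) \<in> R j}"
      if "(x, y) \<in> R k" for x y
      using bose_mesner_constant_on_relations[OF disj closed[OF \<open>i \<le> d\<close> \<open>j \<le> d\<close>] \<open>k \<le> d\<close> that k0]
      unfolding adj_matrix_mult_nth X by simp
    then show ?thesis by blast
  qed
  define p where "p i j k = (SOME c. \<forall>(x, y)\<in>R k. card {z \<in> X. (x, z) \<in> R i \<and> (z, y) \<in> R j} = c)" for i j k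
  have "\<forall>(x, y)\<in>R k. card {z \<in> X. (x, z) \<in> R i \<and> (z, y) \<in> R j} = p i j k"
    if "i \<le> d" "j \<le> d" "k \<le> d" for i j k
    unfolding p_def by (rule someI_ex) (rule const[OF that])
  then have "\<exists>p :: nat \<Rightarrow> nat \<Rightarrow> nat \<Rightarrow> nat. \<forall>i\<le>d. \<forall>j\<le>d. \<forall>k\<le>d. \<forall>(x, y)\<in>R k.
        card {z \<in> X. (x, z) \<in> R i \<and> (z, y) \<in> R j} = p i j k"
    by blast
  then show ?thesis
    unfolding association_scheme_def using assms(1,5,6) inj part by simp
qed

section \<open>Spans of orthogonal idempotents and column spaces\<close>

lemma matrix_mult_scaleR [simp]:
  fixes A :: "real ^ 'm::finite ^ 'n::finite" and B :: "real ^ 'k ^ 'm"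
  shows "(c *\<^sub>R A) ** B = c *\<^sub>R (A ** B)" and "A ** (c *\<^sub>R B) = c *\<^sub>R (A ** B)"
  by (auto simp: matrix_matrix_mult_def vec_eq_iff sum_distrib_left algebra_simps)

lemma matrix_mult_sum:
  fixes A :: "real ^ 'm::finite ^ 'n::finite" and B :: "'i \<Rightarrow> real ^ 'k ^ 'm"
  shows "A ** (\<Sum>i\<in>I. B i) = (\<Sum>i\<in>I. A ** B i)"
  by (induction I rule: infinite_finite_induct) (auto simp: matrix_add_ldistrib)

lemma matrix_add_rdistrib:
  fixes A B :: "real ^ 'm::finite ^ 'n::finite" and C :: "real ^ 'k ^ 'm"
  shows "(A + B) ** C = A ** C + B ** C"
  by (auto simp: matrix_matrix_mult_def vec_eq_iff sum.distrib algebra_simps)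

lemma sum_matrix_mult:
  fixes A :: "'i \<Rightarrow> real ^ 'm::finite ^ 'n::finite" and B :: "real ^ 'k ^ 'm"
  shows "(\<Sum>i\<in>I. A i) ** B = (\<Sum>i\<in>I. A i ** B)"
  by (induction I rule: infinite_finite_induct) (auto simp: matrix_add_rdistrib)

text \<open>In coordinates with respect to orthogonal idempotents multiplication is coordinatewise,
  so the idempotents of the span have coordinates 0 and 1, and the minimal ones have a single
  1.\<close>

lemma minimal_idempotents_span_orthogonal:
  fixes E :: "nat \<Rightarrow> real ^ 'p::finite ^ 'p"
  assumes nz: "\<And>i. i \<le> d \<Longrightarrow> E i \<noteq> 0"
    and orth: "\<And>i j. i \<le> d \<Longrightarrow> j \<le> d \<Longrightarrow> E i ** E j = (if i = j then E i else 0)"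
  shows "bij_betw E {..d} (minimal_idempotents (span (E ` {..d})))"
proof -
  have inj: "inj_on E {..d}"
    by (rule inj_onI) (metis orth nz atMost_iff)
  \<comment> \<open>The coordinate \<open>f i\<close> is at the same time the scalar by which
    \<open>F\<close> acts on \<open>E i\<close> from either side.\<close>
  have expand: "\<exists>f. F = (\<Sum>i\<le>d. f i *\<^sub>R E i) \<and>
      (\<forall>i\<le>d. E i ** F = f i *\<^sub>R E i \<and> F ** E i = f i *\<^sub>R E i)"
    if FA: "F \<in> span (E ` {..d})" for F
  proof -
    obtain g where "F = (\<Sum>M\<in>E ` {..d}. g M *\<^sub>R M)"
      using FA by (auto simp: span_finite)
    then have F: "F = (\<Sum>i\<le>d. g (E i) *\<^sub>R E i)"
      by (simp add: sum.reindex[OF inj])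
    have "E i ** F = g (E i) *\<^sub>R E i \<and> F ** E i = g (E i) *\<^sub>R E i" if "i \<le> d" for i
    proof
      have "E i ** F = (\<Sum>j\<le>d. if i = j then g (E i) *\<^sub>R E i else 0)"
        unfolding F matrix_mult_sum using that by (intro sum.cong) (auto simp: orth)
      then show "E i ** F = g (E i) *\<^sub>R E i" using that by simp
      have "F ** E i = (\<Sum>j\<le>d. if i = j then g (E i) *\<^sub>R E i else 0)"
        unfolding F sum_matrix_mult using that by (intro sum.cong) (auto simp: orth)
      then show "F ** E i = g (E i) *\<^sub>R E i" using that by simp
    qed
    with F show ?thesis by (intro exI[of _ "\<lambda>i. g (E i)"]) auto
  qed
  have "E i \<in> minimal_idempotents (span (E ` {..d}))" if i: "i \<le> d" for i
  proof -
    have "F = 0 \<or> F = E i"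
      if F: "F \<in> span (E ` {..d})" "F ** F = F" "E i ** F = F" for F
    proof -
      obtain f where f: "E i ** F = f *\<^sub>R E i" using expand[OF F(1)] i by blast
      then have Ff: "F = f *\<^sub>R E i" using F by simp
      then have "(f * f) *\<^sub>R E i = f *\<^sub>R E i" using F(2) orth[OF i i] by simp
      then have "f * f = f" using nz[OF i] by (simp only: scaleR_cancel_right) simp
      then have "f = 0 \<or> f = 1" by simp
      then show ?thesis using Ff by auto
    qed
    moreover have "E i \<in> span (E ` {..d})" using i by (intro span_base) auto
    ultimately show ?thesis
      unfolding minimal_idempotents_def using nz[OF i] orth[OF i i] by simp
  qed
  moreover have "F \<in> E ` {..d}" if F: "F \<in> minimal_idempotents (span (E ` {..d}))" for F
  proof -
    have FA: "F \<in> span (E ` {..d})" and "F \<noteq> 0" and FF: "F ** F = F"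
      and min: "\<And>G. G \<in> span (E ` {..d}) \<Longrightarrow> G ** G = G \<Longrightarrow> F ** G = G \<Longrightarrow> G ** F = G \<Longrightarrow> G = 0 \<or> G = F"
      using F unfolding minimal_idempotents_def by auto
    obtain f where f: "F = (\<Sum>i\<le>d. f i *\<^sub>R E i)"
      and fE: "\<And>i. i \<le> d \<Longrightarrow> E i ** F = f i *\<^sub>R E i" "\<And>i. i \<le> d \<Longrightarrow> F ** E i = f i *\<^sub>R E i"
      using expand[OF FA] by blast
    have "\<exists>i\<le>d. f i \<noteq> 0"
    proof (rule ccontr)
      assume "\<not> ?thesis"
      then have "F = 0" unfolding f by (intro sum.neutral) auto
      with \<open>F \<noteq> 0\<close> show False by simp
    qed
    then obtain i where i: "i \<le> d" "f i \<noteq> 0" by auto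
    \<comment> \<open>Multiplying \<open>F ** F = F\<close> by \<open>E i\<close> gives
      \<open>f i * f i = f i\<close>. Hence \<open>f i = 1\<close>, so \<open>E i\<close> is a
      nonzero idempotent below the minimal \<open>F\<close>.\<close>
    have "(E i ** F) ** F = E i ** F" by (simp add: FF flip: matrix_mul_assoc)
    then have "(f i * f i) *\<^sub>R E i = f i *\<^sub>R E i" by (simp add: fE[OF i(1)])
    then have "f i * f i = f i" using nz[OF i(1)] by (simp only: scaleR_cancel_right) simp
    then have "f i = 1" using i by simp
    then have "E i = 0 \<or> E i = F"
      using i fE[OF i(1)] orth[OF i(1) i(1)] by (intro min) (auto intro: span_base)
    then show ?thesis using nz[OF i(1)] i by auto
  qed
  ultimately show ?thesis
    unfolding bij_betw_def using inj by auto
qed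

text \<open>A column of \<open>E\<close> is the image of a unit vector, so the matrix equation gives
  the eigenvector equation on columns, and linearity extends it to their span.\<close>

lemma columns_eigenvalue:
  fixes A E :: "real ^ 'p::finite ^ 'p"
  assumes "A ** E = c *\<^sub>R E" and "v \<in> span (columns E)"
  shows "A *v v = c *\<^sub>R v"
  using assms(2)
proof (induction rule: span_induct)
  show "subspace {v. A *v v = c *\<^sub>R v}"
    by (auto simp: subspace_def matrix_vector_right_distrib matrix_vector_mult_scaleR scaleR_right_distrib)
next
  fix v assume "v \<in> columns E"
  then obtain j where "v = column j E" by (auto simp: columns_def)
  then have v: "v = E *v axis j 1" by (simp add: matrix_vector_mult_basis)
  show "A *v v = c *\<^sub>R v"
    unfolding v matrix_vector_mul_assoc assms(1)
    by (simp add: scaleR_matrix_vector_assoc)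
qed

section \<open>Graphs with an antipodal involution\<close>

text \<open>The relations of \<open>Omega_rel\<close> for an arbitrary graph and involution, so that
  the algebra can be done from the parameters of the graph alone.\<close>

definition antipodal_rel :: "'p set \<Rightarrow> ('p \<Rightarrow> 'p \<Rightarrow> bool) \<Rightarrow> ('p \<Rightarrow> 'p) \<Rightarrow> nat \<Rightarrow> ('p \<times> 'p) set" where
  "antipodal_rel X adj \<sigma> i =
     {(x, y). x \<in> X \<and> y \<in> X \<and>
       [x = y,
        \<not> adj y x \<and> adj x (\<sigma> y),
        \<not> adj y x \<and> \<not> adj x (\<sigma> y) \<and> x \<noteq> y \<and> x \<noteq> \<sigma> y,
        adj y x \<and> \<not> adj x (\<sigma> y),
        x = \<sigma> y] ! i}"

text \<open>The last three assumptions are the counts supplied by the geometry, with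
  \<open>q * u\<close> in the role of q^(n-1). The three values for common neighbours belong to
  relations 3, 1 and 2. For \<open>x = y\<close> the number is the valency, and for
  \<open>x = \<sigma> y\<close> it is 0 by \<open>adj_not_sigma\<close>.\<close>

locale antipodal_graph =
  fixes X :: "'p::finite set" and adj :: "'p \<Rightarrow> 'p \<Rightarrow> bool" and \<sigma> :: "'p \<Rightarrow> 'p" and q u :: real
  assumes q: "q > 2" and u: "u > 1"
    and sigma_in: "x \<in> X \<Longrightarrow> \<sigma> x \<in> X"
    and sigma_sigma: "x \<in> X \<Longrightarrow> \<sigma> (\<sigma> x) = x"
    and sigma_neq: "x \<in> X \<Longrightarrow> \<sigma> x \<noteq> x"
    and adj_sym: "x \<in> X \<Longrightarrow> y \<in> X \<Longrightarrow> adj x y \<Longrightarrow> adj y x"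
    and adj_irrefl: "x \<in> X \<Longrightarrow> \<not> adj x x"
    and adj_sigma: "x \<in> X \<Longrightarrow> y \<in> X \<Longrightarrow> adj (\<sigma> x) (\<sigma> y) \<longleftrightarrow> adj x y"
    and adj_not_sigma: "x \<in> X \<Longrightarrow> y \<in> X \<Longrightarrow> adj x y \<Longrightarrow> \<not> adj x (\<sigma> y)"
    and not_adj_sigma_self: "x \<in> X \<Longrightarrow> \<not> adj x (\<sigma> x)"
    and card_X: "real (card X) = q * u * (q * u - 1)"
    and valency: "x \<in> X \<Longrightarrow> real (card {z \<in> X. adj x z}) = (u - 1) * (q * u + 1)"
    and common_neighbours: "x \<in> X \<Longrightarrow> y \<in> X \<Longrightarrow> x \<noteq> y \<Longrightarrow> x \<noteq> \<sigma> y \<Longrightarrow>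
      real (card {z \<in> X. adj x z \<and> adj z y}) =
        (if adj x y then u\<^sup>2 - q * u + u - 2 else if adj x (\<sigma> y) then u\<^sup>2 else u\<^sup>2 - u)"
begin

abbreviation "R \<equiv> antipodal_rel X adj \<sigma>"
abbreviation "A i \<equiv> adj_matrix (R i)"
abbreviation "J \<equiv> all_ones X"

lemma adj_commute: "x \<in> X \<Longrightarrow> y \<in> X \<Longrightarrow> adj x y \<longleftrightarrow> adj y x"
  using adj_sym by blast

lemma adj_sigma_swap: "x \<in> X \<Longrightarrow> y \<in> X \<Longrightarrow> adj (\<sigma> x) y \<longleftrightarrow> adj x (\<sigma> y)"
  using adj_sigma[of x "\<sigma> y"] by (simp add: sigma_in sigma_sigma)

lemma sigma_eq_iff: "x \<in> X \<Longrightarrow> y \<in> X \<Longrightarrow> \<sigma> x = y \<longleftrightarrow> x = \<sigma> y"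
  using sigma_sigma by auto

lemma mem_rel:
  "(x, y) \<in> R 0 \<longleftrightarrow> x \<in> X \<and> y \<in> X \<and> x = y"
  "(x, y) \<in> R (Suc 0) \<longleftrightarrow> x \<in> X \<and> y \<in> X \<and> adj x (\<sigma> y)"
  "(x, y) \<in> R 2 \<longleftrightarrow> x \<in> X \<and> y \<in> X \<and> \<not> adj x y \<and> \<not> adj x (\<sigma> y) \<and> x \<noteq> y \<and> x \<noteq> \<sigma> y"
  "(x, y) \<in> R 3 \<longleftrightarrow> x \<in> X \<and> y \<in> X \<and> adj x y"
  "(x, y) \<in> R 4 \<longleftrightarrow> x \<in> X \<and> y \<in> X \<and> x = \<sigma> y"
  by (auto simp: antipodal_rel_def adj_commute dest: adj_not_sigma)

lemma X_nonempty: "X \<noteq> {}"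
proof
  assume "X = {}"
  then have "q * u * (q * u - 1) = 0" using card_X by simp
  moreover have "q * u > 1" using q u by (simp add: less_1_mult)
  ultimately show False using q u by auto
qed

text \<open>\<open>A 3\<close> is the adjacency matrix of the graph, \<open>A 4\<close> that of \<open>\<sigma>\<close>, and \<open>A 1\<close> is their product.\<close>

definition bm :: "real \<Rightarrow> real \<Rightarrow> real \<Rightarrow> real \<Rightarrow> real \<Rightarrow> real ^ 'p ^ 'p" where
  "bm a b c d e = a *\<^sub>R A 0 + b *\<^sub>R A 4 + c *\<^sub>R A 3 + d *\<^sub>R A (Suc 0) + e *\<^sub>R J"

lemma bm_add: "bm a b c d e + bm a' b' c' d' e' = bm (a + a') (b + b') (c + c') (d + d') (e + e')"
  by (simp add: bm_def algebra_simps)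

lemma bm_scaleR: "r *\<^sub>R bm a b c d e = bm (r * a) (r * b) (r * c) (r * d) (r * e)"
  by (simp add: bm_def algebra_simps)

lemma exclusive:
  assumes "x \<in> X" "y \<in> X"
  shows "x = y \<Longrightarrow> \<not> adj x y \<and> \<not> adj x (\<sigma> y) \<and> x \<noteq> \<sigma> y"
    and "x = \<sigma> y \<Longrightarrow> \<not> adj x y \<and> \<not> adj x (\<sigma> y)"
    and "adj x y \<Longrightarrow> \<not> adj x (\<sigma> y)"
proof -
  show "x = y \<Longrightarrow> \<not> adj x y \<and> \<not> adj x (\<sigma> y) \<and> x \<noteq> \<sigma> y"
    using assms adj_irrefl not_adj_sigma_self sigma_neq by metis
  show "x = \<sigma> y \<Longrightarrow> \<not> adj x y \<and> \<not> adj x (\<sigma> y)"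
    using assms adj_irrefl not_adj_sigma_self adj_commute by metis
  show "adj x y \<Longrightarrow> \<not> adj x (\<sigma> y)"
    using assms adj_not_sigma by metis
qed

text \<open>The other four relations are disjoint by \<open>exclusive\<close>, so \<open>A 2\<close>
  is what they leave of \<open>J\<close>. This lets \<open>J\<close> take the place of
  \<open>A 2\<close> in the basis behind \<open>bm\<close>.\<close>

lemma A2_eq: "A 2 = J - A 0 - A (Suc 0) - A 3 - A 4"
proof -
  have "A 2 $ x $ y = (J - A 0 - A (Suc 0) - A 3 - A 4) $ x $ y" for x y
  proof (cases "x \<in> X \<and> y \<in> X")
    case True
    then show ?thesis using exclusive[of x y]
      by (cases "x = y"; cases "x = \<sigma> y"; cases "adj x y"; cases "adj x (\<sigma> y)")
        (simp_all add: adj_matrix_def all_ones_def mem_rel)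
  next
    case False
    then show ?thesis by (auto simp: adj_matrix_def all_ones_def mem_rel)
  qed
  then show ?thesis by (simp add: vec_eq_iff)
qed

lemma A_eq_bm: "A 0 = bm 1 0 0 0 0" "A (Suc 0) = bm 0 0 0 1 0" "A 2 = bm (-1) (-1) (-1) (-1) 1"
  "A 3 = bm 0 0 1 0 0" "A 4 = bm 0 1 0 0 0" "J = bm 0 0 0 0 1"
  unfolding A2_eq by (simp_all add: bm_def)

section \<open>Multiplication table of the algebra\<close>

lemma A0_mult_nth: "(A 0 ** M) $ x $ y = (if x \<in> X then M $ x $ y else 0)"
proof -
  have "(A 0 ** M) $ x $ y = (\<Sum>z\<in>UNIV. if z = x then (if x \<in> X then M $ x $ y else 0) else 0)"
    unfolding matrix_matrix_mult_def vec_lambda_beta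
    by (intro sum.cong) (auto simp: adj_matrix_def mem_rel)
  then show ?thesis by simp
qed

lemma A4_mult_nth: "(A 4 ** M) $ x $ y = (if x \<in> X then M $ \<sigma> x $ y else 0)"
proof -
  have "(A 4 ** M) $ x $ y = (\<Sum>z\<in>UNIV. if z = \<sigma> x then (if x \<in> X then M $ \<sigma> x $ y else 0) else 0)"
    unfolding matrix_matrix_mult_def vec_lambda_beta
    by (intro sum.cong) (auto simp: adj_matrix_def mem_rel sigma_in sigma_sigma)
  then show ?thesis by simp
qed

lemma J_mult_nth: "(J ** M) $ x $ y = (if x \<in> X then \<Sum>z\<in>X. M $ z $ y else 0)"
proof -
  have "(J ** M) $ x $ y = (\<Sum>z\<in>UNIV. if z \<in> X then (if x \<in> X then M $ z $ y else 0) else 0)"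
    unfolding matrix_matrix_mult_def vec_lambda_beta
    by (intro sum.cong) (auto simp: all_ones_def)
  then show ?thesis by (simp add: sum.If_cases)
qed

lemma A0_mult_bm: "A 0 ** bm a b c d e = bm a b c d e"
  unfolding vec_eq_iff A0_mult_nth
  by (auto simp: bm_def adj_matrix_def all_ones_def mem_rel)

text \<open>Left multiplication by \<open>A 4\<close> replaces row \<open>x\<close> by row
  \<open>\<sigma> x\<close>. Since \<open>\<sigma>\<close> preserves adjacency, this swaps relations
  0 and 4 and relations 1 and 3.\<close>

lemma A4_mult_bm: "A 4 ** bm a b c d e = bm b a d c e"
  unfolding vec_eq_iff A4_mult_nth
  by (auto simp: bm_def adj_matrix_def all_ones_def mem_rel sigma_in sigma_sigma sigma_eq_iff
      adj_sigma adj_sigma_swap)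

lemma J_mult_A:
  "J ** A 0 = J" "J ** A 4 = J" "J ** J = (q * u * (q * u - 1)) *\<^sub>R J"
  "J ** A 3 = ((u - 1) * (q * u + 1)) *\<^sub>R J" "J ** A (Suc 0) = ((u - 1) * (q * u + 1)) *\<^sub>R J"
proof -
  have val: "real (card {z \<in> X. adj z y}) = (u - 1) * (q * u + 1)" if "y \<in> X" for y
  proof -
    have "{z \<in> X. adj z y} = {z \<in> X. adj y z}" using adj_commute that by blast
    then show ?thesis using valency[OF that] by simp
  qed
  \<comment> \<open>An entry of \<open>J ** adj_matrix r\<close> is a column sum, so a relation with
    constant in-degree \<open>c\<close> yields \<open>c\<close> times \<open>J\<close>.\<close>
  have Jadj: "J ** adj_matrix r = c *\<^sub>R J"
    if "r \<subseteq> X \<times> X" and c: "\<And>y. y \<in> X \<Longrightarrow> real (card {z \<in> X. (z, y) \<in> r}) = c" for r c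
  proof -
    have "(J ** adj_matrix r) $ x $ y = (c *\<^sub>R J) $ x $ y" for x y
    proof -
      have "(\<Sum>z\<in>X. adj_matrix r $ z $ y) = (\<Sum>z\<in>{z \<in> X. (z, y) \<in> r}. 1)"
        by (simp only: adj_matrix_def vec_lambda_beta sum.inter_filter[OF finite])
      also have "\<dots> = (if y \<in> X then c else 0)"
        using c that(1) by auto
      finally show ?thesis by (simp add: J_mult_nth) (simp add: all_ones_def)
    qed
    then show ?thesis by (simp add: vec_eq_iff)
  qed
  have R: "{z \<in> X. (z, y) \<in> R 0} = {y}" "{z \<in> X. (z, y) \<in> R 4} = {\<sigma> y}"
    "{z \<in> X. (z, y) \<in> R 3} = {z \<in> X. adj z y}" "{z \<in> X. (z, y) \<in> R (Suc 0)} = {z \<in> X. adj z (\<sigma> y)}"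
    if "y \<in> X" for y
    using that by (auto simp: mem_rel sigma_in)
  have "J ** A 0 = 1 *\<^sub>R J" "J ** A 4 = 1 *\<^sub>R J"
    by (rule Jadj, force simp: mem_rel, simp add: R)+
  then show "J ** A 0 = J" "J ** A 4 = J" by simp_all
  show "J ** J = (q * u * (q * u - 1)) *\<^sub>R J"
    using card_X by (simp add: vec_eq_iff J_mult_nth) (simp add: all_ones_def)
  show "J ** A 3 = ((u - 1) * (q * u + 1)) *\<^sub>R J" "J ** A (Suc 0) = ((u - 1) * (q * u + 1)) *\<^sub>R J"
    by (rule Jadj, force simp: mem_rel, simp add: R val sigma_in)+
qed

lemma J_mult_bm:
  "J ** bm a b c d e =
     bm 0 0 0 0 (a + b + (u - 1) * (q * u + 1) * (c + d) + q * u * (q * u - 1) * e)"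
  unfolding bm_def by (simp add: matrix_add_ldistrib J_mult_A algebra_simps)

text \<open>The coefficients are read off from the common neighbours. Pairs in relation 2 fix the
  coefficient of \<open>J\<close> as \<open>u\<^sup>2 - u\<close>, and every other coefficient is
  the count for its relation minus this value; for \<open>A 4\<close> it is
  \<open>0 - (u\<^sup>2 - u)\<close>.\<close>

lemma A3_mult_A3:
  "A 3 ** A 3 =
     bm (q * u\<^sup>2 - q * u - u\<^sup>2 + 2 * u - 1) (u - u\<^sup>2) (2 * u - q * u - 2) u (u\<^sup>2 - u)"
proof -
  have "(A 3 ** A 3) $ x $ y =
     bm (q * u\<^sup>2 - q * u - u\<^sup>2 + 2 * u - 1) (u - u\<^sup>2) (2 * u - q * u - 2) u (u\<^sup>2 - u) $ x $ y"
    (is "_ = ?r $ x $ y") for x y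
  proof -
    have E: "(A 3 ** A 3) $ x $ y = (if x \<in> X \<and> y \<in> X then real (card {z \<in> X. adj x z \<and> adj z y}) else 0)"
    proof -
      have "{z. (x, z) \<in> R 3 \<and> (z, y) \<in> R 3} =
          (if x \<in> X \<and> y \<in> X then {z \<in> X. adj x z \<and> adj z y} else {})"
        by (auto simp: mem_rel)
      then show ?thesis unfolding adj_matrix_mult_nth by simp
    qed
    note entries = bm_def adj_matrix_def mem_rel all_ones_def
    have out: ?thesis if "x \<notin> X \<or> y \<notin> X"
    proof -
      have "?r $ x $ y = 0" using that by (auto simp: entries)
      then show ?thesis using E that by auto
    qed
    have eq: ?thesis if "x \<in> X" "x = y"
    proof -
      have "{z \<in> X. adj x z \<and> adj z y} = {z \<in> X. adj x z}" using adj_sym[of x] that by auto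
      then have "(A 3 ** A 3) $ x $ y = (u - 1) * (q * u + 1)" using E that valency[of x] by simp
      moreover have "?r $ x $ y = (u - 1) * (q * u + 1)"
        using that sigma_neq[of x] adj_irrefl[of x] not_adj_sigma_self[of x]
        by (auto simp: entries algebra_simps power2_eq_square)
      ultimately show ?thesis by (rule trans[OF _ sym])
    qed
    \<comment> \<open>A common neighbour of \<open>y\<close> and \<open>\<sigma> y\<close> would
      contradict \<open>adj_not_sigma\<close>.\<close>
    have anti: ?thesis if "x \<in> X" "y \<in> X" "x = \<sigma> y" "x \<noteq> y"
    proof -
      have "{z \<in> X. adj x z \<and> adj z y} = {}"
        using that adj_sym[of x] adj_not_sigma[of _ y] by auto
      then have "(A 3 ** A 3) $ x $ y = 0" using E by simp
      moreover have "\<not> adj x y" "\<not> adj x x"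
        using that adj_sym[of x y] not_adj_sigma_self[of y] adj_irrefl[of x] by auto
      then have "?r $ x $ y = 0" using that by (simp add: entries)
      ultimately show ?thesis by (rule trans[OF _ sym])
    qed
    have generic: ?thesis if "x \<in> X" "y \<in> X" "x \<noteq> y" "x \<noteq> \<sigma> y"
    proof -
      have "(A 3 ** A 3) $ x $ y =
        (if adj x y then u\<^sup>2 - q * u + u - 2 else if adj x (\<sigma> y) then u\<^sup>2 else u\<^sup>2 - u)"
        using E that common_neighbours[of x y] by simp
      moreover have "?r $ x $ y =
        (if adj x y then u\<^sup>2 - q * u + u - 2 else if adj x (\<sigma> y) then u\<^sup>2 else u\<^sup>2 - u)"
        using that adj_not_sigma[of x y] by (simp add: entries)
      ultimately show ?thesis by (rule trans[OF _ sym])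
    qed
    show ?thesis using out eq anti generic by argo
  qed
  then show ?thesis unfolding vec_eq_iff by blast
qed

lemma A1_eq: "A (Suc 0) = A 4 ** A 3" "A (Suc 0) = A 3 ** A 4"
proof -
  show "A (Suc 0) = A 4 ** A 3" unfolding A_eq_bm(4) A4_mult_bm by (simp add: A_eq_bm)
  have "{z. (x, z) \<in> R 3 \<and> (z, y) \<in> R 4} = (if x \<in> X \<and> y \<in> X \<and> adj x (\<sigma> y) then {\<sigma> y} else {})" for x y
    by (auto simp: mem_rel sigma_in)
  then show "A (Suc 0) = A 3 ** A 4"
    unfolding vec_eq_iff adj_matrix_mult_nth by (simp add: adj_matrix_def mem_rel)
qed

text \<open>By \<open>A1_eq\<close> the matrices \<open>A 3\<close> and \<open>A 4\<close> commute,
  so \<open>A 3 ** A (Suc 0)\<close> is \<open>A 4 ** (A 3 ** A 3)\<close>, which is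
  \<open>A3_mult_A3\<close> with its coefficients swapped in pairs.\<close>

lemma A3_mult_bm:
  "A 3 ** bm a b c d e =
     bm ((q * u\<^sup>2 - q * u - u\<^sup>2 + 2 * u - 1) * c + (u - u\<^sup>2) * d)
        ((u - u\<^sup>2) * c + (q * u\<^sup>2 - q * u - u\<^sup>2 + 2 * u - 1) * d)
        (a + (2 * u - q * u - 2) * c + u * d)
        (b + u * c + (2 * u - q * u - 2) * d)
        ((u - 1) * (q * u + 1) * e + (u\<^sup>2 - u) * (c + d))"
proof -
  have "A 3 ** A (Suc 0) = A (Suc 0) ** A 3" by (metis A1_eq matrix_mul_assoc)
  also have "\<dots> = A 4 ** (A 3 ** A 3)" by (metis A1_eq matrix_mul_assoc)
  finally have A31: "A 3 ** A (Suc 0) = A 4 ** (A 3 ** A 3)" .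
  have A30: "A 3 ** A 0 = A 3"
  proof -
    have "{z. (x, z) \<in> R 3 \<and> (z, y) \<in> R 0} = (if (x, y) \<in> R 3 then {y} else {})" for x y
      by (auto simp: mem_rel)
    then show ?thesis
      unfolding vec_eq_iff adj_matrix_mult_nth by (simp add: adj_matrix_def)
  qed
  have A3J: "A 3 ** J = ((u - 1) * (q * u + 1)) *\<^sub>R J"
  proof -
    have "(A 3 ** J) $ x $ y = (if x \<in> X \<and> y \<in> X then real (card {z \<in> X. adj x z}) else 0)" for x y
    proof -
      have "(A 3 ** J) $ x $ y = (\<Sum>z\<in>UNIV. if z \<in> {z \<in> X. adj x z} then (if x \<in> X \<and> y \<in> X then 1 else 0) else 0)"
        unfolding matrix_matrix_mult_def vec_lambda_beta
        by (intro sum.cong) (auto simp: all_ones_def adj_matrix_def mem_rel)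
      then show ?thesis unfolding sum.inter_restrict[symmetric, OF finite] by simp
    qed
    then show ?thesis
      by (simp add: vec_eq_iff all_ones_def valency)
  qed
  have "A 3 ** bm a b c d e = a *\<^sub>R A 3 + b *\<^sub>R A (Suc 0) + c *\<^sub>R (A 3 ** A 3) + d *\<^sub>R (A 4 ** (A 3 ** A 3))
      + e *\<^sub>R (A 3 ** J)"
    unfolding bm_def by (simp only: matrix_add_ldistrib matrix_mult_scaleR A30 A31 flip: A1_eq)
  then show ?thesis
    unfolding A3J A3_mult_A3 A4_mult_bm
    by (simp add: A_eq_bm bm_add bm_scaleR algebra_simps)
qed

lemma A1_mult_bm: "A (Suc 0) ** M = A 3 ** (A 4 ** M)"
  by (simp add: A1_eq(2) matrix_mul_assoc)

lemma bm_mult: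
  "bm a b c d e ** M = a *\<^sub>R (A 0 ** M) + b *\<^sub>R (A 4 ** M) + c *\<^sub>R (A 3 ** M)
     + d *\<^sub>R (A 3 ** (A 4 ** M)) + e *\<^sub>R (J ** M)"
  unfolding bm_def by (simp only: matrix_add_rdistrib matrix_mult_scaleR A1_mult_bm)

lemmas bm_mult_bm = bm_mult A0_mult_bm A4_mult_bm A3_mult_bm J_mult_bm bm_add bm_scaleR

section \<open>Axioms of the association scheme\<close>

lemma bm_in_bose_mesner: "bm a b c d e \<in> bose_mesner 4 R"
proof -
  have "J = A 0 + A (Suc 0) + A 2 + A 3 + A 4" unfolding A2_eq by simp
  then have "bm a b c d e = a *\<^sub>R A 0 + b *\<^sub>R A 4 + c *\<^sub>R A 3 + d *\<^sub>R A (Suc 0) + e *\<^sub>R (A 0 + A (Suc 0) + A 2 + A 3 + A 4)"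
    by (simp add: bm_def)
  moreover have "A i \<in> span ((\<lambda>i. A i) ` {..4})" if "i \<le> 4" for i
    using that by (intro span_base) auto
  ultimately show ?thesis
    unfolding bose_mesner_def by (auto intro!: span_add span_scale)
qed

lemma le_4_cases: "(i::nat) \<le> 4 \<longleftrightarrow> i = 0 \<or> i = Suc 0 \<or> i = 2 \<or> i = 3 \<or> i = 4"
  by auto

lemma bm_mult_in_bose_mesner: "bm a b c d e ** bm a' b' c' d' e' \<in> bose_mesner 4 R"
  by (simp add: bm_mult_bm bm_in_bose_mesner)

lemma A_mult_A_in_bose_mesner:
  assumes "i \<le> 4" "j \<le> 4" shows "A i ** A j \<in> bose_mesner 4 R"
proof -
  have "\<exists>a b c d e. A i = bm a b c d e" if "i \<le> 4" for i
    using that A_eq_bm unfolding le_4_cases by metis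
  then show ?thesis using assms bm_mult_in_bose_mesner by metis
qed

text \<open>Relation 2 needs a count. If it were empty, \<open>x\<close>, its antipode, the
  neighbours of \<open>x\<close> and their antipodes would cover \<open>X\<close>, but
  \<open>card X\<close> exceeds \<open>2 + 2 * (u - 1) * (q * u + 1)\<close> by
  \<open>u * (q - 2) * (q * u + 1)\<close>, which is positive since \<open>q > 2\<close>.\<close>

lemma rel_nonempty: assumes "i \<le> 4" shows "R i \<noteq> {}"
proof -
  obtain x where x: "x \<in> X" using X_nonempty by auto
  have qu: "q * u > 1" using q u by (simp add: less_1_mult)
  have "(u - 1) * (q * u + 1) > 0" using q u qu by simp
  then have "{z \<in> X. adj x z} \<noteq> {}" using valency[OF x] by (metis card.empty less_irrefl of_nat_0)
  then obtain z where z: "z \<in> X" "adj x z" by auto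
  have R2: "R 2 \<noteq> {}"
  proof
    assume R2: "R 2 = {}"
    have "X \<subseteq> {x, \<sigma> x} \<union> {z \<in> X. adj x z} \<union> \<sigma> ` {z \<in> X. adj x z}"
    proof
      fix y assume y: "y \<in> X"
      then have "x = y \<or> x = \<sigma> y \<or> adj x y \<or> adj x (\<sigma> y)" using R2 x mem_rel(3)[of x y] by auto
      then show "y \<in> {x, \<sigma> x} \<union> {z \<in> X. adj x z} \<union> \<sigma> ` {z \<in> X. adj x z}"
        using y sigma_sigma[OF y] sigma_in[OF y] by (auto simp: image_iff)
    qed
    then have "card X \<le> card ({x, \<sigma> x} \<union> {z \<in> X. adj x z} \<union> \<sigma> ` {z \<in> X. adj x z})"
      by (intro card_mono) auto
    also have "\<dots> \<le> card {x, \<sigma> x} + card {z \<in> X. adj x z} + card (\<sigma> ` {z \<in> X. adj x z})"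
      by (meson card_Un_le add_le_mono1 order_trans)
    also have "\<dots> \<le> 2 + card {z \<in> X. adj x z} + card {z \<in> X. adj x z}"
      by (intro add_mono card_image_le) (auto simp: card_insert_if)
    finally have "real (card X) \<le> 2 + 2 * real (card {z \<in> X. adj x z})" by simp
    then have "q * u * (q * u - 1) \<le> 2 + 2 * ((u - 1) * (q * u + 1))"
      unfolding card_X valency[OF x] .
    moreover have "q * u * (q * u - 1) - (2 + 2 * ((u - 1) * (q * u + 1))) = u * (q - 2) * (q * u + 1)"
      by (simp add: algebra_simps)
    moreover have "u * (q - 2) * (q * u + 1) > 0" using q u qu by simp
    ultimately show False by linarith
  qed
  have "(x, x) \<in> R 0" "(x, \<sigma> z) \<in> R (Suc 0)" "(x, z) \<in> R 3" "(\<sigma> x, x) \<in> R 4"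
    using x z by (auto simp: mem_rel sigma_in sigma_sigma)
  then have "R 0 \<noteq> {}" "R (Suc 0) \<noteq> {}" "R 3 \<noteq> {}" "R 4 \<noteq> {}" by (metis empty_iff)+
  with R2 show ?thesis using assms unfolding le_4_cases by metis
qed

lemma rel_disjoint: assumes "i \<le> 4" "j \<le> 4" "i \<noteq> j" shows "R i \<inter> R j = {}"
proof -
  have False if "(x, y) \<in> R i" "(x, y) \<in> R j" for x y
  proof -
    have "x \<in> X" "y \<in> X" using that by (auto simp: antipodal_rel_def)
    then show False using assms that exclusive[of x y] unfolding le_4_cases
      by (elim disjE; simp add: mem_rel)
  qed
  then show ?thesis by auto
qed

lemma rel_cover: "(\<Union>i\<le>4. R i) = X \<times> X"
proof -
  have "(x, y) \<in> (\<Union>i\<le>4. R i) \<longleftrightarrow> (x, y) \<in> X \<times> X" for x y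
    unfolding UN_iff atMost_iff Bex_def le_4_cases by (simp add: conj_disj_distribR ex_disj_distrib mem_rel) blast
  then show ?thesis by auto
qed

lemma rel_sym: assumes "i \<le> 4" shows "sym (R i)"
proof (rule symI)
  fix x y assume xy: "(x, y) \<in> R i"
  then have X: "x \<in> X" "y \<in> X" by (auto simp: antipodal_rel_def)
  have "adj y (\<sigma> x) \<longleftrightarrow> adj x (\<sigma> y)" "adj y x \<longleftrightarrow> adj x y" "y = \<sigma> x \<longleftrightarrow> x = \<sigma> y"
    using X adj_commute[of y "\<sigma> x"] adj_commute[of x y] sigma_eq_iff[of x y]
    by (auto simp: sigma_in adj_sigma_swap)
  then show "(y, x) \<in> R i" using xy assms X unfolding le_4_cases
    by (elim disjE; simp add: mem_rel; metis)
qed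

lemma scheme: "association_scheme X 4 R"
  by (rule association_schemeI[OF X_nonempty rel_nonempty rel_disjoint rel_cover _ rel_sym A_mult_A_in_bose_mesner])
    (auto simp: Id_on_iff mem_rel)

section \<open>Idempotents and eigenvalues\<close>

text \<open>Lagrange interpolation on the eigenspaces of T = \<open>A 4\<close>, with A =
  \<open>A 3\<close>. \<open>idem 1\<close> and \<open>idem 3\<close> are (I - T)/2 times (A - b)/(a
  - b), where a is the root \<open>-(q * u + 1)\<close> or \<open>u - 1\<close> belonging to the
  idempotent and b is the other one. \<open>idem 2\<close> and \<open>idem 4\<close> use (I + T)/2
  and the roots \<open>u - 1\<close> and \<open>-u * (q - 2) - 1\<close>; their multiple of
  \<open>J\<close> makes \<open>J\<close> annihilate them.\<close>

definition idem :: "nat \<Rightarrow> real ^ 'p ^ 'p" where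
  "idem i =
     [bm 0 0 0 0 (1 / (q * u * (q * u - 1))),
      (1 / (2 * u * (q + 1))) *\<^sub>R bm (u - 1) (1 - u) (-1) 1 0,
      (1 / (2 * u * (q - 1))) *\<^sub>R bm (u * (q - 2) + 1) (u * (q - 2) + 1) 1 1 (- (2 / q)),
      (1 / (2 * u * (q + 1))) *\<^sub>R bm (q * u + 1) (- (q * u + 1)) 1 (-1) 0,
      (1 / (2 * u * (q - 1))) *\<^sub>R bm (u - 1) (u - 1) (-1) (-1) (2 * (u - 1) / (q * u - 1))] ! i"

text \<open>Columns 3 and 4 hold the eigenvalues of the graph and of \<open>\<sigma>\<close>. Column
  1 is their product, and column 2 follows from \<open>A2_eq\<close>.\<close>

definition eigval :: "nat \<Rightarrow> nat \<Rightarrow> real" where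
  "eigval i l =
     [[1, (u - 1) * (q * u + 1), u * (q - 2) * (q * u + 1), (u - 1) * (q * u + 1), 1],
      [1, q * u + 1, 0, - (q * u + 1), -1],
      [1, u - 1, - (2 * u), u - 1, 1],
      [1, - (u - 1), 0, u - 1, -1],
      [1, - (u * (q - 2)) - 1, 2 * u * (q - 2), - (u * (q - 2)) - 1, 1]] ! i ! l"

lemma idem_simps:
  "idem 0 = bm 0 0 0 0 (1 / (q * u * (q * u - 1)))"
  "idem (Suc 0) = (1 / (2 * u * (q + 1))) *\<^sub>R bm (u - 1) (1 - u) (-1) 1 0"
  "idem 2 = (1 / (2 * u * (q - 1))) *\<^sub>R bm (u * (q - 2) + 1) (u * (q - 2) + 1) 1 1 (- (2 / q))"
  "idem 3 = (1 / (2 * u * (q + 1))) *\<^sub>R bm (q * u + 1) (- (q * u + 1)) 1 (-1) 0"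
  "idem 4 = (1 / (2 * u * (q - 1))) *\<^sub>R bm (u - 1) (u - 1) (-1) (-1) (2 * (u - 1) / (q * u - 1))"
  by (simp_all add: idem_def)

lemma qu_gt_1: "q * u > 1"
  using q u by (simp add: less_1_mult)

lemma nonzero: "q \<noteq> 0" "u \<noteq> 0" "q * u - 1 \<noteq> 0" "q + 1 \<noteq> 0" "q - 1 \<noteq> 0" "q * u \<noteq> 1" "1 + q \<noteq> 0" "q \<noteq> 1"
  using q u qu_gt_1 by auto

lemma bm_cong: "a = a' \<Longrightarrow> b = b' \<Longrightarrow> c = c' \<Longrightarrow> d = d' \<Longrightarrow> e = e' \<Longrightarrow> bm a b c d e = bm a' b' c' d' e'"
  by simp

lemma A3_mult_idem: "i \<le> 4 \<Longrightarrow> A 3 ** idem i = eigval i 3 *\<^sub>R idem i"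
proof -
  \<comment> \<open>Cancels the scalar prefactor of \<open>idem i\<close>, which leaves one identity
    for each coefficient of \<open>bm\<close>.\<close>
  have scale: "r *\<^sub>R M = c *\<^sub>R (r *\<^sub>R M')" if "M = c *\<^sub>R M'" for r c :: real and M M' :: "real ^ 'p ^ 'p"
    using that by simp
  have "A 3 ** idem 0 = eigval 0 3 *\<^sub>R idem 0"
    by (simp add: idem_simps eigval_def A3_mult_bm bm_scaleR)
  moreover have "A 3 ** idem (Suc 0) = eigval (Suc 0) 3 *\<^sub>R idem (Suc 0)"
    unfolding idem_simps matrix_mult_scaleR A3_mult_bm
    by (rule scale, unfold bm_scaleR, rule bm_cong) (simp_all add: eigval_def algebra_simps power2_eq_square)
  moreover have "A 3 ** idem 2 = eigval 2 3 *\<^sub>R idem 2"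
    unfolding idem_simps matrix_mult_scaleR A3_mult_bm
    by (rule scale, unfold bm_scaleR, rule bm_cong)
      (simp_all add: eigval_def nonzero divide_simps, simp_all add: algebra_simps power2_eq_square)
  moreover have "A 3 ** idem 3 = eigval 3 3 *\<^sub>R idem 3"
    unfolding idem_simps matrix_mult_scaleR A3_mult_bm
    by (rule scale, unfold bm_scaleR, rule bm_cong) (simp_all add: eigval_def algebra_simps power2_eq_square)
  moreover have "A 3 ** idem 4 = eigval 4 3 *\<^sub>R idem 4"
    unfolding idem_simps matrix_mult_scaleR A3_mult_bm
    by (rule scale, unfold bm_scaleR, rule bm_cong)
      (simp_all add: eigval_def nonzero divide_simps, simp_all add: algebra_simps power2_eq_square)
  ultimately show "i \<le> 4 \<Longrightarrow> A 3 ** idem i = eigval i 3 *\<^sub>R idem i"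
    unfolding le_4_cases by metis
qed

lemma A4_mult_idem: "i \<le> 4 \<Longrightarrow> A 4 ** idem i = eigval i 4 *\<^sub>R idem i"
  unfolding le_4_cases
  by (elim disjE; simp add: idem_simps eigval_def A4_mult_bm bm_scaleR add.commute)

lemma A0_mult_idem: "i \<le> 4 \<Longrightarrow> A 0 ** idem i = idem i"
  unfolding le_4_cases
  by (elim disjE; simp add: idem_simps A0_mult_bm)

lemma J_mult_idem: "i \<le> 4 \<Longrightarrow> J ** idem i = (if i = 0 then q * u * (q * u - 1) else 0) *\<^sub>R idem i"
proof -
  have zero: "bm 0 0 0 0 0 = 0" by (simp add: bm_def)
  have "u * (q - 2) + 1 + (u * (q - 2) + 1) + (u - 1) * (q * u + 1) * 2 + q * u * (q * u - 1) * (- (2 / q)) = 0"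
    by (simp add: nonzero divide_simps) (simp add: algebra_simps)
  then have J2: "J ** idem 2 = 0"
    unfolding idem_simps matrix_mult_scaleR J_mult_bm using zero by simp
  have "u - 1 + (u - 1) + (u - 1) * (q * u + 1) * (- 2) + q * u * (q * u - 1) * (2 * (u - 1) / (q * u - 1)) = 0"
    by (simp add: nonzero divide_simps) (simp add: algebra_simps)
  then have J4: "J ** idem 4 = 0"
    unfolding idem_simps matrix_mult_scaleR J_mult_bm using zero by simp
  have "J ** idem 0 = (q * u * (q * u - 1)) *\<^sub>R idem 0"
    by (simp add: idem_simps J_mult_bm bm_scaleR)
  moreover have "J ** idem (Suc 0) = 0" "J ** idem 3 = 0"
    by (simp_all add: idem_simps J_mult_bm zero)
  ultimately show "i \<le> 4 \<Longrightarrow> J ** idem i = (if i = 0 then q * u * (q * u - 1) else 0) *\<^sub>R idem i"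
    using J2 J4 unfolding le_4_cases by (elim disjE) simp_all
qed

text \<open>Every basis matrix acts on \<open>idem i\<close> as a scalar, so products with the
  idempotents reduce to arithmetic with eigenvalues.\<close>

lemma bm_mult_idem:
  assumes "i \<le> 4"
  shows "bm a b c d e ** idem i = (a + b * eigval i 4 + c * eigval i 3 + d * eigval i 4 * eigval i 3
    + e * (if i = 0 then q * u * (q * u - 1) else 0)) *\<^sub>R idem i"
  unfolding bm_mult by (simp add: A3_mult_idem A4_mult_idem A0_mult_idem J_mult_idem assms algebra_simps)

lemma A_mult_idem:
  assumes "i \<le> 4" "l \<le> 4"
  shows "A l ** idem i = eigval i l *\<^sub>R idem i"
  using assms(2) assms(1) unfolding le_4_cases[of l]
  apply (elim disjE; simp add: A_eq_bm bm_mult_idem)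
  using assms(1) unfolding le_4_cases
  by (auto simp: eigval_def algebra_simps)

lemma idem_mult_idem:
  assumes "i \<le> 4" "j \<le> 4"
  shows "idem i ** idem j = (if i = j then idem i else 0)"
proof -
  \<comment> \<open>The scalar by which \<open>idem i\<close> acts on \<open>idem j\<close> is an
    interpolation polynomial evaluated at a root, hence 0 or 1.\<close>
  have "\<exists>c. idem i ** idem j = c *\<^sub>R idem j \<and> c = (if i = j then 1 else 0)"
    using assms(1) unfolding le_4_cases[of i]
    apply (elim disjE; simp add: idem_simps bm_mult_idem[OF assms(2)])
    using assms(2) unfolding le_4_cases[of j]
    by (auto simp: eigval_def nonzero field_simps)
  then show ?thesis by auto
qed

lemma sum_idem: "(\<Sum>i\<le>4. idem i) = A 0"
proof -
  have "{..4::nat} = {0, Suc 0, 2, 3, 4}" by auto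
  then have "(\<Sum>i\<le>4. idem i) = idem 0 + idem (Suc 0) + idem 2 + idem 3 + idem 4" by simp
  also have "\<dots> = A 0"
    by (simp add: idem_simps bm_scaleR bm_add A_eq_bm)
      (rule bm_cong; simp add: nonzero divide_simps; simp add: algebra_simps)
  finally show ?thesis .
qed

text \<open>On the diagonal only \<open>A 0\<close> and \<open>J\<close> contribute, so the first
  and last coefficients decide.\<close>

lemma idem_nonzero: assumes "i \<le> 4" shows "idem i \<noteq> 0"
proof -
  obtain x where x: "x \<in> X" using X_nonempty by auto
  then have diag: "bm a b c d e $ x $ x = a + e" for a b c d e
    using exclusive[of x x] by (simp add: bm_def adj_matrix_def mem_rel all_ones_def)
  have "u * (q - 2) + 1 - 2 / q > 0"
  proof -
    have "2 / q < 1" "u * (q - 2) > 0" using q u by auto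
    then show ?thesis by linarith
  qed
  moreover have "u - 1 + 2 * (u - 1) / (q * u - 1) > 0"
    using u qu_gt_1 by (intro add_pos_pos) auto
  ultimately have "idem i $ x $ x \<noteq> 0"
    using assms q u qu_gt_1 unfolding le_4_cases by (elim disjE; simp add: idem_simps diag)
  then show ?thesis by auto
qed

text \<open>The idempotents sum to \<open>A 0\<close>, the identity of the algebra, so
  \<open>A l\<close> is their combination with coefficients from column \<open>l\<close> of
  \<open>eigval\<close>.\<close>

lemma bose_mesner_eq_span_idem: "bose_mesner 4 R = span (idem ` {..4})"
proof
  show "bose_mesner 4 R \<subseteq> span (idem ` {..4})"
    unfolding bose_mesner_def
  proof (rule span_minimal)
    have "A l \<in> span (idem ` {..4})" if l: "l \<le> 4" for l
    proof -
      have "A l = A l ** (\<Sum>i\<le>4. idem i)"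
      proof -
        have "{z. (x, z) \<in> R l \<and> (z, y) \<in> R 0} = (if (x, y) \<in> R l then {y} else {})" for x y
          by (auto simp: antipodal_rel_def)
        then show ?thesis
          unfolding sum_idem vec_eq_iff adj_matrix_mult_nth by (simp add: adj_matrix_def)
      qed
      also have "\<dots> = (\<Sum>i\<le>4. eigval i l *\<^sub>R idem i)"
        unfolding matrix_mult_sum using l by (intro sum.cong) (auto simp: A_mult_idem)
      also have "\<dots> \<in> span (idem ` {..4})"
        by (intro span_sum span_scale span_base) auto
      finally show ?thesis .
    qed
    then show "(\<lambda>i. A i) ` {..4} \<subseteq> span (idem ` {..4})" by auto
  qed simp
  have "idem i \<in> bose_mesner 4 R" if "i \<le> 4" for i
    using that unfolding le_4_cases
    by (elim disjE; simp add: idem_simps bm_scaleR bm_in_bose_mesner)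
  then show "span (idem ` {..4}) \<subseteq> bose_mesner 4 R"
    by (intro span_minimal) (auto simp: bose_mesner_def)
qed

lemma idempotents:
  "bij_betw idem {..4} (minimal_idempotents (bose_mesner 4 R))"
  "idem 0 = (1 / real (card X)) *\<^sub>R all_ones X"
  "eigenvalue_matrix 4 R idem eigval"
proof -
  show "bij_betw idem {..4} (minimal_idempotents (bose_mesner 4 R))"
    unfolding bose_mesner_eq_span_idem
    by (intro minimal_idempotents_span_orthogonal idem_nonzero idem_mult_idem)
  show "idem 0 = (1 / real (card X)) *\<^sub>R all_ones X"
    by (simp add: idem_simps card_X bm_def)
  show "eigenvalue_matrix 4 R idem eigval"
    unfolding eigenvalue_matrix_def using columns_eigenvalue A_mult_idem by blast
qed

end

section \<open>Quadratic forms over finite fields\<close>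

lemma sum_if_const:
  "finite Z \<Longrightarrow> (\<Sum>z\<in>Z. if P z then c else 0) = (c :: nat) * card {z \<in> Z. P z}"
  by (simp add: sum.inter_filter[symmetric])

text \<open>A point with \<open>g z \<noteq> 0\<close> is a zero for exactly one \<open>s\<close>; a
  point with \<open>g z = 0\<close> is a zero for all \<open>s\<close> or for none. This trades a
  count of common zeros for counts of zeros of the single functions
  \<open>f + s * g\<close>.\<close>

lemma sum_card_affine_pencil:
  fixes f g :: "'b \<Rightarrow> 'a::{field,finite}"
  assumes "finite Z"
  shows "(\<Sum>s\<in>UNIV. card {z \<in> Z. f z + s * g z = 0}) =
    CARD('a) * card {z \<in> Z. f z = 0 \<and> g z = 0} + card {z \<in> Z. g z \<noteq> 0}"
proof -
  have one: "card {s. f z + s * g z = 0} = 1" if "g z \<noteq> 0" for z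
  proof -
    have "{s. f z + s * g z = 0} = {- f z / g z}"
      using that by (auto simp: field_simps eq_neg_iff_add_eq_0)
    then show ?thesis by simp
  qed
  have "(\<Sum>s\<in>UNIV. card {z \<in> Z. f z + s * g z = 0})
      = (\<Sum>s\<in>UNIV. \<Sum>z\<in>Z. if f z + s * g z = 0 then 1 else 0)"
    using assms by (simp add: sum_if_const)
  also have "\<dots> = (\<Sum>z\<in>Z. \<Sum>s\<in>UNIV. if f z + s * g z = 0 then 1 else 0)"
    by (rule sum.swap)
  also have "\<dots> = (\<Sum>z\<in>Z. card {s. f z + s * g z = 0})"
    by (simp add: sum_if_const)
  also have "\<dots> = (\<Sum>z\<in>Z. (if f z = 0 \<and> g z = 0 then CARD('a) else 0) + (if g z \<noteq> 0 then 1 else 0))"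
    using one by (intro sum.cong) auto
  also have "\<dots> = CARD('a) * card {z \<in> Z. f z = 0 \<and> g z = 0} + card {z \<in> Z. g z \<noteq> 0}"
    unfolding sum.distrib using assms by (simp add: sum_if_const)
  finally show ?thesis .
qed

text \<open>Translations by multiples of a vector of value 1 identify all level sets.\<close>

lemma card_level_set_functional:
  fixes W :: "('a::{field,finite} ^ 'd::finite) set" and \<phi> :: "'a ^ 'd \<Rightarrow> 'a"
  assumes W: "vec.subspace W"
    and add: "\<And>x y. \<phi> (x + y) = \<phi> x + \<phi> y" and scale: "\<And>c x. \<phi> (c *s x) = c * \<phi> x"
    and w: "w \<in> W" "\<phi> w \<noteq> 0"
  shows "CARD('a) * card {x \<in> W. \<phi> x = a} = card W"
proof -
  define e where "e = (1 / \<phi> w) *s w"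
  have e: "e \<in> W" "\<phi> e = 1"
    using W w by (auto simp: e_def scale vec.subspace_scale)
  have level: "card {x \<in> W. \<phi> x = b} = card {x \<in> W. \<phi> x = 0}" for b
  proof (rule bij_betw_same_card[symmetric], rule bij_betwI)
    show "(\<lambda>x. x + b *s e) \<in> {x \<in> W. \<phi> x = 0} \<rightarrow> {x \<in> W. \<phi> x = b}"
      using e W by (auto simp: add scale vec.subspace_scale vec.subspace_add)
    have "\<phi> (x + (- b) *s e) = \<phi> x - b" for x unfolding add scale e by simp
    then show "(\<lambda>x. x + (- b) *s e) \<in> {x \<in> W. \<phi> x = b} \<rightarrow> {x \<in> W. \<phi> x = 0}"
      using e W by (auto intro!: vec.subspace_scale vec.subspace_diff)
  qed auto
  have "card W = (\<Sum>b\<in>UNIV. card {x \<in> W. \<phi> x = b})"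
    using sum.group[of W "UNIV :: 'a set" \<phi> "\<lambda>_. 1 :: nat"] by simp
  also have "\<dots> = (\<Sum>b\<in>(UNIV :: 'a set). card {x \<in> W. \<phi> x = a})"
    by (intro sum.cong refl trans[OF level level[symmetric]])
  finally show ?thesis by simp
qed

lemma card_span_independent:
  fixes S :: "('a::{field,finite} ^ 'd::finite) set"
  assumes "vec.independent S"
  shows "card (vec.span S) = CARD('a) ^ card S"
  using vec.finiteI_independent[OF assms] assms
proof (induction S rule: finite_induct)
  case empty
  then show ?case by simp
next
  case (insert b S)
  have b: "b \<notin> vec.span S" and "vec.independent S"
    using insert.prems insert.hyps by (auto simp: vec.independent_insert)
  have "bij_betw (\<lambda>(c, y). c *s b + y) (UNIV \<times> vec.span S) (vec.span (insert b S))"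
  proof (rule bij_betw_imageI)
    show "inj_on (\<lambda>(c, y). c *s b + y) (UNIV \<times> vec.span S)"
    proof (rule inj_onI, clarify)
      fix c y c' y' assume y: "y \<in> vec.span S" "y' \<in> vec.span S" and eq: "c *s b + y = c' *s b + y'"
      define k where "k = c - c'"
      have "k *s b = y' - y" unfolding k_def using eq by (simp add: vector_sub_rdistrib algebra_simps)
      moreover have "y' - y \<in> vec.span S" using y by (simp add: vec.span_diff)
      ultimately have "(1 / k) *s (k *s b) \<in> vec.span S" by (metis vec.span_scale)
      then have "k = 0" using b by (cases "k = 0") auto
      then have "c = c'" by (simp add: k_def)
      then show "c = c' \<and> y = y'" using eq by simp
    qed
    have "x \<in> (\<lambda>(c, y). c *s b + y) ` (UNIV \<times> vec.span S)" if "x - k *s b \<in> vec.span S" for x k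
      using that by (intro image_eqI[of _ _ "(k, x - k *s b)"]) auto
    moreover have "\<exists>k. (c *s b + y) - k *s b \<in> vec.span S" if "y \<in> vec.span S" for c y
      using that by (intro exI[of _ c]) simp
    ultimately show "(\<lambda>(c, y). c *s b + y) ` (UNIV \<times> vec.span S) = vec.span (insert b S)"
      unfolding vec.span_insert by (intro equalityI subsetI) (auto simp del: add_diff_cancel_left')
  qed
  from bij_betw_same_card[OF this] have "card (vec.span (insert b S)) = CARD('a) * card (vec.span S)"
    by (simp add: card_cartesian_product)
  then show ?case using insert \<open>vec.independent S\<close> by simp
qed

lemma card_subspace:
  fixes W :: "('a::{field,finite} ^ 'd::finite) set"
  assumes "vec.subspace W"
  shows "card W = CARD('a) ^ vec.dim W"
proof -
  obtain S where "S \<subseteq> W" "vec.independent S" "W \<subseteq> vec.span S" "card S = vec.dim W"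
    using vec.basis_exists[of W] by metis
  then show ?thesis
    using card_span_independent[of S] vec.span_minimal[of S W] assms by auto
qed

lemma CARD_field_ge_2: "CARD('a::{field,finite}) \<ge> 2"
proof -
  have "card {0, 1 :: 'a} \<le> CARD('a)" by (rule card_mono) auto
  then show ?thesis by simp
qed

section \<open>Quadratic forms and polar subspaces\<close>

locale quadratic_space =
  fixes Q :: "'a::{field,finite} ^ 'd::finite \<Rightarrow> 'a"
  assumes form: "quadratic_form Q"
begin

abbreviation "B \<equiv> polar_form Q"

lemma Q_scale: "Q (c *s x) = c\<^sup>2 * Q x"
  using form by (simp add: quadratic_form_def)

lemma Q_zero [simp]: "Q 0 = 0"
  using Q_scale[of 0 0] by simp

lemma Q_add: "Q (x + y) = Q x + Q y + B x y"
  by (simp add: polar_form_def)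

lemma B_commute: "B x y = B y x"
  by (simp add: polar_form_def algebra_simps)

lemma B_add_left: "B (x + y) z = B x z + B y z"
  using form by (simp add: quadratic_form_def)

lemma B_add_right: "B z (x + y) = B z x + B z y"
  using B_add_left B_commute by metis

lemma B_scale_left: "B (c *s x) z = c * B x z"
  using form by (simp add: quadratic_form_def)

lemma B_scale_right: "B z (c *s x) = c * B z x"
  using B_scale_left B_commute by metis

lemma B_zero [simp]: "B 0 z = 0" "B z 0 = 0"
  using B_scale_left[of 0 0 z] B_scale_right[of z 0 0] by simp_all

lemma B_minus: "B (- x) z = - B x z" "B z (- x) = - B z x"
  using B_scale_left[of "-1" x z] B_scale_right[of z "-1" x] by simp_all

lemma Q_minus: "Q (- x) = Q x"
  using Q_scale[of "-1" x] by simp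

lemma B_diff: "B (x - y) z = B x z - B y z" "B z (x - y) = B z x - B z y"
  using B_add_left[of x "- y" z] B_add_right[of z x "- y"] by (simp_all add: B_minus)

lemma Q_diff: "Q (x - y) = Q x + Q y - B x y"
  using Q_add[of x "- y"] by (simp add: B_minus Q_minus)

lemma B_self: "B x x = 2 * Q x"
proof -
  have "x + x = 2 *s x" by (simp add: vec_eq_iff)
  then show ?thesis by (simp add: polar_form_def Q_scale)
qed

lemma subspace_polarity: "vec.subspace (polarity Q W)"
  by (auto simp: polarity_def vec.subspace_def B_add_left B_scale_left)

lemma card_B_level:
  assumes "vec.subspace W" "w \<in> W" "B v w \<noteq> 0"
  shows "CARD('a) * card {w \<in> W. B v w = a} = card W"
  using assms card_level_set_functional[of W "B v" w a] by (simp add: B_add_right B_scale_right)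

text \<open>Double counting of the pairs with \<open>B v w = 0\<close>: for fixed \<open>v\<close>
  they fill all of \<open>W\<close> or a fraction 1/q of it, and for fixed \<open>w\<close> all of
  the space or a fraction 1/q of it. The factor \<open>?q\<close> keeps the counts integral.\<close>

lemma card_polarity:
  assumes W: "vec.subspace W" and rad: "\<And>w. w \<in> W \<Longrightarrow> w \<noteq> 0 \<Longrightarrow> \<exists>v. B v w \<noteq> 0"
  shows "card W * card (polarity Q W) = CARD('a) ^ CARD('d)"
proof -
  let ?q = "CARD('a)" and ?V = "CARD('a) ^ CARD('d)" and ?P = "polarity Q W"
  have "0 \<in> W" using W by (rule vec.subspace_0)
  have "(\<Sum>v\<in>UNIV. ?q * card {w \<in> W. B v w = 0}) = (\<Sum>v\<in>UNIV. if v \<in> ?P then ?q * card W else card W)"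
  proof (intro sum.cong refl)
    fix v
    show "?q * card {w \<in> W. B v w = 0} = (if v \<in> ?P then ?q * card W else card W)"
    proof (cases "v \<in> ?P")
      case True
      then have "{w \<in> W. B v w = 0} = W" by (auto simp: polarity_def)
      then show ?thesis using True by simp
    next
      case False
      then obtain w where "w \<in> W" "B v w \<noteq> 0" by (auto simp: polarity_def)
      then show ?thesis using False card_B_level[OF W] by simp
    qed
  qed
  also have "\<dots> = card ?P * (?q * card W) + (?V - card ?P) * card W"
    by (simp add: sum.If_cases Compl_eq_Diff_UNIV card_Diff_subset)
  finally have 1: "(\<Sum>v\<in>UNIV. ?q * card {w \<in> W. B v w = 0})
    = card ?P * (?q * card W) + (?V - card ?P) * card W" .
  have "(\<Sum>v\<in>UNIV. ?q * card {w \<in> W. B v w = 0}) = (\<Sum>v\<in>UNIV. \<Sum>w\<in>W. if B v w = 0 then ?q else 0)"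
    by (simp add: sum_if_const)
  also have "\<dots> = (\<Sum>w\<in>W. \<Sum>v\<in>UNIV. if B v w = 0 then ?q else 0)"
    by (rule sum.swap)
  also have "\<dots> = (\<Sum>w\<in>W. ?q * card {v \<in> UNIV. B w v = 0})"
    by (simp add: sum_if_const B_commute)
  also have "\<dots> = (\<Sum>w\<in>W. if w = 0 then ?q * ?V else ?V)"
  proof (intro sum.cong refl)
    fix w assume "w \<in> W"
    show "?q * card {v \<in> UNIV. B w v = 0} = (if w = 0 then ?q * ?V else ?V)"
    proof (cases "w = 0")
      case False
      then obtain v where "B w v \<noteq> 0" using rad \<open>w \<in> W\<close> B_commute by metis
      then show ?thesis using False card_B_level[of UNIV v w 0] by simp
    qed simp
  qed
  also have "\<dots> = ?q * ?V + (card W - 1) * ?V"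
    using \<open>0 \<in> W\<close> by (simp add: sum.remove[of W 0])
  finally have "card ?P * (?q * card W) + (?V - card ?P) * card W = ?q * ?V + (card W - 1) * ?V"
    using 1 by simp
  \<comment> \<open>Over the reals the subtractions are not truncated, and \<open>?q - 1\<close> can
    be cancelled.\<close>
  then have "real (card ?P * (?q * card W) + (?V - card ?P) * card W) = real (?q * ?V + (card W - 1) * ?V)"
    by (rule arg_cong)
  moreover have "card ?P \<le> ?V" by (metis CARD_vec card_mono finite subset_UNIV)
  moreover have "1 \<le> card W" using \<open>0 \<in> W\<close> by (metis One_nat_def Suc_leI card_gt_0_iff empty_iff finite)
  ultimately have "real (card ?P) * (real ?q * real (card W)) + (real ?V - real (card ?P)) * real (card W)
      = real ?q * real ?V + (real (card W) - 1) * real ?V"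
    by (simp only: of_nat_add of_nat_mult of_nat_diff of_nat_1)
  then have "(real ?q - 1) * (real (card W) * real (card ?P)) = (real ?q - 1) * real ?V"
    by (simp only: algebra_simps)
  moreover have "real ?q - 1 \<noteq> 0" using CARD_field_ge_2[where 'a = 'a] by simp
  ultimately have "real (card W) * real (card ?P) = real ?V" by (simp only: mult_cancel_left) simp
  then show ?thesis by (metis of_nat_eq_iff of_nat_mult)
qed

end

lemma card_roots_affine:
  fixes \<alpha> \<beta> :: "'a::{field,finite}"
  shows "card {s. \<alpha> * s + \<beta> = 0} = (if \<alpha> \<noteq> 0 then 1 else if \<beta> = 0 then CARD('a) else 0)"
proof (cases "\<alpha> = 0")
  case False
  then have "{s. \<alpha> * s + \<beta> = 0} = {- \<beta> / \<alpha>}"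
    by (auto simp: field_simps eq_neg_iff_add_eq_0)
  then show ?thesis using False by simp
qed auto

lemma subspace_dim_1_eq_span:
  fixes X :: "('a::{field,finite} ^ 'd::finite) set"
  assumes X: "vec.subspace X" "vec.dim X = 1" and v: "v \<in> X" "v \<noteq> 0"
  shows "X = vec.span {v}"
proof -
  have "card (vec.span {v}) = CARD('a) ^ 1"
    using card_span_independent[of "{v}"] v by simp
  also have "\<dots> = card X" using card_subspace[OF X(1)] X(2) by simp
  finally have "card (vec.span {v}) = card X" .
  moreover have "vec.span {v} \<subseteq> X" using X v by (intro vec.span_minimal) auto
  ultimately show ?thesis by (metis card_subset_eq finite)
qed

lemma span_singleton_scale:
  fixes x :: "'a::field ^ 'd::finite"
  assumes "k \<noteq> 0" shows "vec.span {k *s x} = vec.span {x}"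
proof -
  have "(1 / k) *s (k *s x) \<in> vec.span {k *s x}" by (intro vec.span_scale vec.span_base) simp
  then have "x \<in> vec.span {k *s x}" using assms by simp
  moreover have "k *s x \<in> vec.span {x}" by (intro vec.span_scale vec.span_base) simp
  ultimately show ?thesis by (intro equalityI vec.span_minimal) auto
qed

section \<open>Level sets and affine sections of elliptic forms\<close>

locale elliptic_space = quadratic_space Q for Q :: "'a::{field,finite} ^ 'd::finite \<Rightarrow> 'a" +
  fixes n :: nat
  assumes elliptic: "elliptic_form n Q" and n: "n \<ge> 3"
begin

lemma q_ge_2: "CARD('a) \<ge> 2" by (rule CARD_field_ge_2)

lemma dim_d: "CARD('d) = 2 * n"
  using elliptic by (simp add: elliptic_form_def)

lemma singular_radical: "Q v = 0 \<Longrightarrow> (\<And>w. B v w = 0) \<Longrightarrow> v = 0"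
  using elliptic by (simp add: elliptic_form_def nondegenerate_on_def)

lemma witt_set_finite: "finite {vec.dim U | U. vec.subspace U \<and> totally_singular Q U}"
proof -
  have "{vec.dim U | U. vec.subspace U \<and> totally_singular Q U} = vec.dim ` {U. vec.subspace U \<and> totally_singular Q U}"
    by auto
  then show ?thesis by simp
qed

lemma dim_totally_singular:
  assumes "vec.subspace U" "totally_singular Q U"
  shows "vec.dim U \<le> n - 1"
proof -
  have "vec.dim U \<le> witt_index Q"
    unfolding witt_index_def using assms by (intro Max_ge witt_set_finite) auto
  then show ?thesis using elliptic by (simp add: elliptic_form_def)
qed

section \<open>Generators and nondegeneracy of the polar form\<close>

definition generator :: "('a ^ 'd) set \<Rightarrow> bool" where
  "generator U \<longleftrightarrow> vec.subspace U \<and> totally_singular Q U \<and> vec.dim U = n - 1"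

lemma generator_exists: "\<exists>U. generator U"
proof -
  have "vec.subspace {0} \<and> totally_singular Q {0}"
    by (simp add: totally_singular_def)
  then have "{vec.dim U | U. vec.subspace U \<and> totally_singular Q U} \<noteq> {}" by blast
  then have "witt_index Q \<in> {vec.dim U | U. vec.subspace U \<and> totally_singular Q U}"
    unfolding witt_index_def by (intro Max_in witt_set_finite)
  then show ?thesis
    using elliptic unfolding generator_def elliptic_form_def by fastforce
qed

lemma card_generator: "generator U \<Longrightarrow> card U = CARD('a) ^ (n - 1)"
  using card_subspace[of U] by (simp add: generator_def)

lemma generator_subset_polarity:
  assumes "generator U" shows "U \<subseteq> polarity Q U"
proof
  fix u assume u: "u \<in> U"
  have "B u v = 0" if "v \<in> U" for v
    using assms u that by (simp add: polar_form_def generator_def totally_singular_def vec.subspace_add)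
  then show "u \<in> polarity Q U" by (simp add: polarity_def)
qed

text \<open>A singular vector orthogonal to \<open>U\<close> but outside it would span with
  \<open>U\<close> a totally singular subspace of dimension \<open>n\<close>, which exceeds the Witt
  index.\<close>

lemma generator_maximal:
  assumes U: "generator U" and z: "z \<in> polarity Q U" "Q z = 0"
  shows "z \<in> U"
proof (rule ccontr)
  assume "z \<notin> U"
  have sub: "vec.subspace U" and span: "vec.span U = U"
    using U by (auto simp: generator_def)
  have "totally_singular Q (vec.span (insert z U))"
    unfolding totally_singular_def
  proof
    fix x assume "x \<in> vec.span (insert z U)"
    then obtain k where k: "x - k *s z \<in> U" unfolding vec.span_insert span by auto
    then have "Q (x - k *s z) = 0" "B z (x - k *s z) = 0"
      using U z by (auto simp: generator_def totally_singular_def polarity_def)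
    then have "Q ((x - k *s z) + k *s z) = 0"
      by (simp only: Q_add Q_scale B_scale_right B_commute[of _ z] z(2)) simp
    then show "Q x = 0" by simp
  qed
  then have "vec.dim (vec.span (insert z U)) \<le> n - 1" by (intro dim_totally_singular) auto
  moreover have "vec.dim (vec.span (insert z U)) = n - 1 + 1"
  proof -
    have "z \<notin> vec.span U" unfolding span by fact
    then show ?thesis using U by (simp add: generator_def vec.dim_insert)
  qed
  ultimately show False by simp
qed

text \<open>Vectors of \<open>U\<close> are singular, so \<open>singular_radical\<close> already
  keeps them out of the radical. Nondegeneracy of \<open>B\<close> itself is derived later from this
  count.\<close>

lemma card_polarity_generator:
  assumes U: "generator U" shows "card (polarity Q U) = CARD('a) ^ (n + 1)"
proof -
  have "card U * card (polarity Q U) = CARD('a) ^ CARD('d)"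
  proof (rule card_polarity)
    show "vec.subspace U" using U by (simp add: generator_def)
    fix w assume "w \<in> U" "w \<noteq> 0"
    then show "\<exists>v. B v w \<noteq> 0"
      using singular_radical[of w] U B_commute by (auto simp: generator_def totally_singular_def)
  qed
  also have "CARD('a) ^ CARD('d) = CARD('a) ^ (n - 1) * CARD('a) ^ (n + 1)"
    unfolding dim_d power_add[symmetric] using n by (intro arg_cong[of _ _ "(^) CARD('a)"]) simp
  finally show ?thesis using q_ge_2 by (simp add: card_generator[OF U])
qed

text \<open>
  A radical vector \<open>r\<close> is nonsingular, so it only exists in characteristic 2, where every scalar is a
  square. Then some \<open>t + s r\<close> with \<open>t\<close> in the polar space of a generator extends that generator.
\<close>

lemma B_nondegenerate:
  assumes "r \<noteq> 0" shows "\<exists>v. B v r \<noteq> 0"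
proof (rule ccontr)
  assume "\<not> (\<exists>v. B v r \<noteq> 0)"
  then have r: "B v r = 0" "B r v = 0" for v using B_commute[of r v] by auto
  have Qr: "Q r \<noteq> 0" using singular_radical[of r] r assms by auto
  then have "(2::'a) = 0" using B_self[of r] r by simp
  then have neg: "- x = x" for x :: 'a
    by (metis add.right_inverse add_cancel_right_right eq_neg_iff_add_eq_0 mult_2 mult_zero_left)
  have "inj (\<lambda>x::'a. x\<^sup>2)"
    by (rule injI) (auto simp: power2_eq_iff neg)
  then have squares: "\<exists>s. s\<^sup>2 = a" for a :: 'a
    by (metis finite_UNIV_inj_surj finite surjD)
  obtain U where U: "generator U" using generator_exists by auto
  \<comment> \<open>The polar space of \<open>U\<close> has q^(n+1) vectors, too many for the span
    of \<open>U\<close> and \<open>r\<close>; this provides \<open>t\<close>.\<close>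
  have "vec.dim (insert r U) \<le> n"
    using U n by (auto simp: vec.dim_insert generator_def)
  then have "card (vec.span (insert r U)) \<le> CARD('a) ^ n"
    using card_subspace[of "vec.span (insert r U)"] q_ge_2 by (auto intro: power_increasing)
  also have "\<dots> < card (polarity Q U)"
    using q_ge_2 by (simp add: card_polarity_generator[OF U])
  finally have "\<not> polarity Q U \<subseteq> vec.span (insert r U)"
    by (meson card_mono finite leD)
  then obtain t where t: "t \<in> polarity Q U" "t \<notin> vec.span (insert r U)" by auto
  obtain s where s: "s\<^sup>2 = - (Q t / Q r)" using squares by auto
  have "Q (t + s *s r) = 0"
    using Qr by (simp add: Q_add Q_scale B_scale_right r s)
  moreover have "t + s *s r \<in> polarity Q U"
    using t(1) by (simp add: polarity_def B_add_left B_scale_left r)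
  ultimately have "t + s *s r \<in> U" using generator_maximal[OF U] by auto
  then have "t - (- s) *s r \<in> vec.span U" by (simp add: vec.span_base)
  then show False using t(2) unfolding vec.span_insert by blast
qed

lemma card_polarity_subspace:
  "vec.subspace W \<Longrightarrow> card W * card (polarity Q W) = CARD('a) ^ (2 * n)"
  using card_polarity[of W] B_nondegenerate dim_d by auto

lemma polarity_polarity_generator:
  assumes U: "generator U" shows "polarity Q (polarity Q U) = U"
proof -
  have "CARD('a) ^ (n + 1) * card (polarity Q (polarity Q U)) = CARD('a) ^ (2 * n)"
    using card_polarity_subspace[OF subspace_polarity] card_polarity_generator[OF U] by metis
  also have "CARD('a) ^ (2 * n) = CARD('a) ^ (n + 1) * CARD('a) ^ (n - 1)"
    unfolding power_add[symmetric] using n by (intro arg_cong[of _ _ "(^) CARD('a)"]) simp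
  finally have "card (polarity Q (polarity Q U)) = card U"
    using q_ge_2 by (simp add: card_generator[OF U])
  moreover have "U \<subseteq> polarity Q (polarity Q U)"
    using B_commute by (auto simp: polarity_def)
  ultimately show ?thesis by (metis card_subset_eq finite)
qed

section \<open>Sizes of the level sets\<close>

text \<open>For \<open>z\<close> outside the polar space, \<open>Q (z + u) = Q z + B z u\<close>
  takes each value equally often as \<open>u\<close> runs through \<open>U\<close>. Translation by
  \<open>u\<close> preserves the complement of the polar space, so every \<open>u\<close>
  contributes the same number of \<open>z\<close>.\<close>

lemma card_level_outside:
  assumes U: "generator U"
  shows "CARD('a) * card {z. z \<notin> polarity Q U \<and> Q z = c} = CARD('a) ^ (2 * n) - CARD('a) ^ (n + 1)"
proof -
  let ?T = "polarity Q U" and ?N = "\<lambda>u. {z. z \<notin> polarity Q U \<and> Q (z + u) = c}"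
  have sub: "vec.subspace U" using U by (simp add: generator_def)
  have "card (- ?T) * card U = (\<Sum>z\<in>- ?T. CARD('a) * card {u \<in> U. Q (z + u) = c})"
  proof -
    have "CARD('a) * card {u \<in> U. Q (z + u) = c} = card U" if z: "z \<in> - ?T" for z
    proof -
      have "{u \<in> U. Q (z + u) = c} = {u \<in> U. B z u = c - Q z}"
        using U by (auto simp: Q_add generator_def totally_singular_def)
      moreover obtain u where "u \<in> U" "B z u \<noteq> 0" using z by (auto simp: polarity_def)
      ultimately show ?thesis using card_B_level[OF sub, of u z "c - Q z"] by simp
    qed
    then show ?thesis by simp
  qed
  also have "\<dots> = (\<Sum>z\<in>- ?T. \<Sum>u\<in>U. if Q (z + u) = c then CARD('a) else 0)"
    by (simp add: sum_if_const)
  also have "\<dots> = (\<Sum>u\<in>U. \<Sum>z\<in>- ?T. if Q (z + u) = c then CARD('a) else 0)"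
    by (rule sum.swap)
  also have "\<dots> = (\<Sum>u\<in>U. CARD('a) * card (?N 0))"
  proof (intro sum.cong refl)
    fix u assume "u \<in> U"
    then have T: "z + u \<in> ?T \<longleftrightarrow> z \<in> ?T" "z - u \<in> ?T \<longleftrightarrow> z \<in> ?T" for z
      using generator_subset_polarity[OF U] subspace_polarity[of U] vec.subspace_add vec.subspace_diff
      by (metis add_diff_cancel diff_add_cancel subsetD)+
    have "bij_betw (\<lambda>z. z + u) {z \<in> - ?T. Q (z + u) = c} (?N 0)"
      by (rule bij_betwI[where g = "\<lambda>z. z - u"]) (auto simp: T)
    then have "card {z \<in> - ?T. Q (z + u) = c} = card (?N 0)" by (rule bij_betw_same_card)
    then show "(\<Sum>z\<in>- ?T. if Q (z + u) = c then CARD('a) else 0) = CARD('a) * card (?N 0)"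
      by (simp add: sum_if_const)
  qed
  finally have "card (- ?T) * card U = card U * (CARD('a) * card (?N 0))"
    by (simp only: sum_constant of_nat_id)
  then have "CARD('a) * card (?N 0) = card (- ?T)"
    using q_ge_2 card_generator[OF U] by (auto simp: mult_cancel2)
  also have "\<dots> = CARD('a) ^ (2 * n) - CARD('a) ^ (n + 1)"
    by (simp add: Compl_eq_Diff_UNIV card_Diff_subset card_polarity_generator[OF U] dim_d)
  finally show ?thesis by simp
qed

lemma card_level_inside_zero:
  assumes U: "generator U"
  shows "card {z \<in> polarity Q U. Q z = 0} = CARD('a) ^ (n - 1)"
proof -
  have "{z \<in> polarity Q U. Q z = 0} = U"
    using generator_maximal[OF U] generator_subset_polarity[OF U] U
    by (auto simp: generator_def totally_singular_def)
  then show ?thesis by (simp add: card_generator[OF U])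
qed

text \<open>
  A line through \<open>v\<close> in a direction \<open>d\<close> with \<open>Q d \<noteq> 0\<close> meets the level set of \<open>v\<close> in one further point,
  unless \<open>B v d = 0\<close>.
\<close>

lemma card_level_inside_represented:
  assumes U: "generator U" and v: "v \<in> polarity Q U" "Q v = c" and "c \<noteq> 0"
  shows "card {z \<in> polarity Q U. Q z = c} = CARD('a) ^ n + CARD('a) ^ (n - 1)"
proof -
  let ?T = "polarity Q U"
  define D where "D = {d \<in> ?T. B v d \<noteq> 0}"
  define S where "S = {z \<in> ?T. Q z = c \<and> z - v \<notin> U}"
  have T: "vec.subspace ?T" by (rule subspace_polarity)
  have sub: "vec.subspace U" and UT: "U \<subseteq> ?T"
    using U generator_subset_polarity by (auto simp: generator_def)
  have "v \<notin> U" using v U \<open>c \<noteq> 0\<close> by (auto simp: generator_def totally_singular_def)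
  then obtain w where w: "w \<in> ?T" "B v w \<noteq> 0"
    using polarity_polarity_generator[OF U] by (auto simp: polarity_def)
  have vU: "B v u = 0" if "u \<in> U" for u using v that by (simp add: polarity_def)
  have QT: "Q d \<noteq> 0" if "d \<in> ?T" "d \<notin> U" for d using that generator_maximal[OF U] by auto
  \<comment> \<open>For \<open>z = v + d\<close> the equation \<open>Q z = c\<close> reads
    \<open>Q d + B v d = 0\<close>.\<close>
  have Q_line: "Q z = c \<longleftrightarrow> Q (z - v) = - B v (z - v)" for z
    using v by (simp add: Q_diff B_diff B_self B_commute[of z v])
  \<comment> \<open>Each \<open>z\<close> in \<open>S\<close> accounts for the q - 1 nonzero
    multiples of its direction \<open>z - v\<close>; together these are the vectors of
    \<open>?T\<close> not orthogonal to \<open>v\<close>.\<close>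
  have "bij_betw (\<lambda>(k, z). k *s (z - v)) ((UNIV - {0}) \<times> S) D"
  proof (rule bij_betw_imageI)
    show "inj_on (\<lambda>(k, z). k *s (z - v)) ((UNIV - {0}) \<times> S)"
    proof (rule inj_onI)
      fix a b assume "a \<in> (UNIV - {0}) \<times> S" "b \<in> (UNIV - {0}) \<times> S"
        and "(\<lambda>(k, z). k *s (z - v)) a = (\<lambda>(k, z). k *s (z - v)) b"
      then obtain k z k' z' where ab: "a = (k, z)" "b = (k', z')" and k: "k \<noteq> 0" "k' \<noteq> 0"
        and z: "z \<in> S" "z' \<in> S" and eq: "k *s (z - v) = k' *s (z' - v)"
        by (cases a, cases b) auto
      define m where "m = k / k'"
      have "(1 / k') *s (k *s (z - v)) = (1 / k') *s (k' *s (z' - v))" using eq by simp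
      then have z': "z' - v = m *s (z - v)" using k by (simp only: vector_smult_assoc m_def) simp
      have "Q (z - v) = - B v (z - v)" "Q (z' - v) = - B v (z' - v)"
        using z Q_line by (auto simp: S_def)
      then have "m\<^sup>2 * Q (z - v) = m * Q (z - v)" unfolding z' Q_scale B_scale_right by simp
      moreover have "Q (z - v) \<noteq> 0"
        using z v T by (intro QT) (auto simp: S_def vec.subspace_diff)
      moreover have "m \<noteq> 0" using k by (simp add: m_def)
      ultimately have "m = 1" by (simp add: power2_eq_square)
      then show "a = b" using z' k by (simp add: m_def ab)
    qed
    show "(\<lambda>(k, z). k *s (z - v)) ` ((UNIV - {0}) \<times> S) = D"
    proof (rule set_eqI, rule iffI)
      fix d assume "d \<in> (\<lambda>(k, z). k *s (z - v)) ` ((UNIV - {0}) \<times> S)"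
      then obtain k z where d: "d = k *s (z - v)" "k \<noteq> 0" "z \<in> S" by auto
      then have "z - v \<in> ?T" "z - v \<notin> U" "Q (z - v) = - B v (z - v)"
        using T v Q_line by (auto simp: S_def vec.subspace_diff)
      moreover from this have "B v d \<noteq> 0" unfolding d(1) B_scale_right using d(2) QT[of "z - v"] by auto
      ultimately show "d \<in> D" unfolding D_def d(1) using T by (simp only: mem_Collect_eq vec.subspace_scale) blast
    next
      fix d assume "d \<in> D"
      then have d: "d \<in> ?T" "B v d \<noteq> 0" by (auto simp: D_def)
      then have "d \<notin> U" using vU by auto
      then have Qd: "Q d \<noteq> 0" using QT d by auto
      \<comment> \<open>The nonzero root of \<open>m\<^sup>2 * Q d + m * B v d = 0\<close>.\<close>
      define m where "m = - (B v d / Q d)"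
      have "m \<noteq> 0" using d Qd by (simp add: m_def)
      have "v + m *s d \<in> S"
        unfolding S_def
      proof (intro CollectI conjI)
        show "v + m *s d \<in> ?T" using T v d by (simp add: vec.subspace_add vec.subspace_scale)
        show "Q (v + m *s d) = c"
          unfolding Q_line add_diff_cancel_left' Q_scale B_scale_right
          using Qd by (simp add: m_def power2_eq_square)
        have "m *s d \<notin> U"
        proof
          assume "m *s d \<in> U"
          then have "(1 / m) *s (m *s d) \<in> U" using sub vec.subspace_scale by blast
          then show False using \<open>m \<noteq> 0\<close> \<open>d \<notin> U\<close> by simp
        qed
        then show "v + m *s d - v \<notin> U" by simp
      qed
      then show "d \<in> (\<lambda>(k, z). k *s (z - v)) ` ((UNIV - {0}) \<times> S)"
        using \<open>m \<noteq> 0\<close> by (intro image_eqI[of _ _ "(1 / m, v + m *s d)"]) auto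
    qed
  qed
  from bij_betw_same_card[OF this] have "(CARD('a) - 1) * card S = card D"
    by (simp add: card_cartesian_product card_Diff_subset)
  also have "\<dots> = card ?T - card {d \<in> ?T. B v d = 0}"
  proof -
    have "D = ?T - {d \<in> ?T. B v d = 0}" by (auto simp: D_def)
    then show ?thesis by (simp add: card_Diff_subset)
  qed
  also have "card {d \<in> ?T. B v d = 0} = CARD('a) ^ n"
    using card_B_level[OF T w, of 0] q_ge_2 by (simp add: card_polarity_generator[OF U])
  also have "card ?T - CARD('a) ^ n = (CARD('a) - 1) * CARD('a) ^ n"
    by (simp add: card_polarity_generator[OF U] algebra_simps)
  finally have S: "card S = CARD('a) ^ n" using q_ge_2 by simp
  \<comment> \<open>The level set minus \<open>S\<close> is the translate of \<open>U\<close> by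
    \<open>v\<close>, on which \<open>Q\<close> is constant because \<open>v\<close> is orthogonal
    to \<open>U\<close>.\<close>
  have "{z \<in> ?T. Q z = c} = S \<union> (\<lambda>u. v + u) ` U"
  proof -
    have "v + u \<in> ?T \<and> Q (v + u) = c" if "u \<in> U" for u
      using that v U UT T vU by (auto simp: Q_add generator_def totally_singular_def intro!: vec.subspace_add)
    moreover have "z \<in> (\<lambda>u. v + u) ` U" if "z - v \<in> U" for z
      using that by (intro image_eqI[of _ _ "z - v"]) auto
    ultimately show ?thesis by (auto simp: S_def)
  qed
  moreover have "card (S \<union> (\<lambda>u. v + u) ` U) = card S + card ((\<lambda>u. v + u) ` U)"
    by (rule card_Un_disjoint) (auto simp: S_def)
  moreover have "card ((\<lambda>u. v + u) ` U) = card U" by (rule card_image) simp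
  ultimately show ?thesis by (simp add: S card_generator[OF U])
qed

text \<open>A nonzero value is taken \<open>?N\<close> times or never. Since
  \<open>CARD('a) ^ (n - 1)\<close> for the value 0 plus q - 1 times \<open>?N\<close> is exactly
  the size of the polar space, no value can be missed.\<close>

lemma card_level_inside_nonzero:
  assumes U: "generator U" and "c \<noteq> 0"
  shows "card {z \<in> polarity Q U. Q z = c} = CARD('a) ^ n + CARD('a) ^ (n - 1)"
proof (rule ccontr)
  let ?T = "polarity Q U" and ?N = "CARD('a) ^ n + CARD('a) ^ (n - 1)"
  assume ne: "card {z \<in> ?T. Q z = c} \<noteq> ?N"
  have le: "card {z \<in> ?T. Q z = b} \<le> ?N" if "b \<noteq> 0" for b
  proof (cases "\<exists>v. v \<in> ?T \<and> Q v = b")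
    case True
    then show ?thesis using card_level_inside_represented[OF U _ _ that] by auto
  next
    case False
    then have "{z \<in> ?T. Q z = b} = {}" by auto
    then show ?thesis by (simp only: card.empty)
  qed
  have "card ?T = (\<Sum>b\<in>UNIV. card {z \<in> ?T. Q z = b})"
    using sum.group[of ?T "UNIV :: 'a set" Q "\<lambda>_. 1 :: nat"] by simp
  also have "\<dots> = CARD('a) ^ (n - 1) + (\<Sum>b\<in>UNIV - {0}. card {z \<in> ?T. Q z = b})"
    by (simp add: sum.remove[of UNIV 0] card_level_inside_zero[OF U])
  also have "(\<Sum>b\<in>UNIV - {0}. card {z \<in> ?T. Q z = b}) < (\<Sum>b\<in>UNIV - {0::'a}. ?N)"
    using le ne \<open>c \<noteq> 0\<close> by (intro sum_strict_mono_ex1) (auto intro!: bexI[of _ c] simp: le_neq_trans)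
  also have "(\<Sum>b\<in>UNIV - {0::'a}. ?N) = (CARD('a) - 1) * ?N" by (simp add: card_Diff_subset)
  finally have "CARD('a) ^ (n + 1) < CARD('a) ^ (n - 1) + (CARD('a) - 1) * ?N"
    by (simp add: card_polarity_generator[OF U])
  moreover have "CARD('a) ^ (n - 1) + (CARD('a) - 1) * ?N = CARD('a) ^ (n + 1)"
  proof -
    obtain m where m: "n = Suc m" using n by (cases n) auto
    obtain k where k: "CARD('a) = Suc k" using q_ge_2 by (cases "CARD('a)") auto
    show ?thesis unfolding m k by (simp add: algebra_simps)
  qed
  ultimately show False by simp
qed

lemma card_level:
  "real (card {z. Q z = c}) = real CARD('a) ^ (2 * n - 1) + real CARD('a) ^ (n - 1) - (if c = 0 then real CARD('a) ^ n else 0)"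
proof -
  obtain U where U: "generator U" using generator_exists by auto
  let ?T = "polarity Q U"
  obtain m where m: "n = Suc m" using n by (cases n) auto
  have "{z. Q z = c} = {z \<in> ?T. Q z = c} \<union> {z. z \<notin> ?T \<and> Q z = c}" by auto
  then have "card {z. Q z = c} = card {z \<in> ?T. Q z = c} + card {z. z \<notin> ?T \<and> Q z = c}"
    by (simp add: card_Un_disjoint Int_def)
  moreover have "real (card {z. z \<notin> ?T \<and> Q z = c}) = real CARD('a) ^ (2 * n - 1) - real CARD('a) ^ n"
  proof -
    have "real CARD('a) * real (card {z. z \<notin> ?T \<and> Q z = c}) = real (CARD('a) ^ (2 * n) - CARD('a) ^ (n + 1))"
      using arg_cong[OF card_level_outside[OF U, of c], of real] by (simp only: of_nat_mult)
    also have "\<dots> = real CARD('a) ^ (2 * n) - real CARD('a) ^ (n + 1)"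
      using q_ge_2 n by (simp add: of_nat_diff power_increasing del: power_Suc)
    also have "\<dots> = real CARD('a) * (real CARD('a) ^ (2 * n - 1) - real CARD('a) ^ n)"
      unfolding m by (simp add: algebra_simps)
    finally show ?thesis using q_ge_2 by simp
  qed
  ultimately show ?thesis
    using card_level_inside_zero[OF U] card_level_inside_nonzero[OF U, of c] by auto
qed

section \<open>Intersections of affine hyperplanes\<close>

lemma card_hyperplanes_1:
  assumes "w \<noteq> 0"
  shows "real (card {z. B z w = a}) = real CARD('a) ^ (2 * n - 1)"
proof -
  obtain v where "B w v \<noteq> 0" using B_nondegenerate[OF assms] B_commute by metis
  then have "CARD('a) * card {z \<in> UNIV. B w z = a} = CARD('a) ^ (2 * n)"
    using card_B_level[of UNIV v w a] by (simp add: dim_d)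
  then have "real (CARD('a) * card {z. B z w = a}) = real (CARD('a) ^ (2 * n))"
    by (simp add: B_commute)
  also have "\<dots> = real CARD('a) * real CARD('a) ^ (2 * n - 1)"
    using n by (cases n) auto
  finally show ?thesis using q_ge_2 by simp
qed

text \<open>All vectors \<open>w1 + s *s w2\<close> are nonzero, so each hyperplane of the pencil
  has known size and \<open>sum_card_affine_pencil\<close> can be solved for the
  intersection.\<close>

lemma card_hyperplanes_2:
  assumes ind: "\<And>s t. s *s w1 + t *s w2 = 0 \<Longrightarrow> s = 0 \<and> t = 0"
  shows "real (card {z. B z w1 = a1 \<and> B z w2 = a2}) = real CARD('a) ^ (2 * n - 2)"
proof -
  have nz: "w1 + s *s w2 \<noteq> 0" "w2 \<noteq> 0" for s
    using ind[of 1 s] ind[of 0 1] by auto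
  have "(\<Sum>s\<in>UNIV. real (card {z. (B z w1 - a1) + s * (B z w2 - a2) = 0})) =
      real CARD('a) * real (card {z. B z w1 = a1 \<and> B z w2 = a2}) + real (card {z. B z w2 \<noteq> a2})"
    using arg_cong[OF sum_card_affine_pencil[of UNIV "\<lambda>z. B z w1 - a1" "\<lambda>z. B z w2 - a2"], of real] by simp
  moreover have "{z. (B z w1 - a1) + s * (B z w2 - a2) = 0} = {z. B z (w1 + s *s w2) = a1 + s * a2}" for s
    by (auto simp: B_add_right B_scale_right algebra_simps)
  moreover have "real (card {z. B z w2 \<noteq> a2}) = real CARD('a) ^ (2 * n) - real CARD('a) ^ (2 * n - 1)"
  proof -
    have "{z. B z w2 \<noteq> a2} = UNIV - {z. B z w2 = a2}" by auto
    then have "real (card {z. B z w2 \<noteq> a2}) = real CARD('a ^ 'd) - real (card {z. B z w2 = a2})"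
      by (simp only: card_Diff_subset finite subset_UNIV of_nat_diff card_mono)
    then show ?thesis using nz by (simp add: card_hyperplanes_1 dim_d)
  qed
  ultimately have "real CARD('a) * real CARD('a) ^ (2 * n - 1) =
      real CARD('a) * real (card {z. B z w1 = a1 \<and> B z w2 = a2})
      + (real CARD('a) ^ (2 * n) - real CARD('a) ^ (2 * n - 1))"
    by (simp add: card_hyperplanes_1 nz)
  moreover obtain k where "n = Suc k" using n by (cases n) auto
  ultimately have "real CARD('a) * real CARD('a) ^ (2 * n - 2) =
      real CARD('a) * real (card {z. B z w1 = a1 \<and> B z w2 = a2})"
    by (simp add: algebra_simps)
  then show ?thesis using q_ge_2 by simp
qed

lemma card_hyperplanes_3:
  assumes ind: "\<And>s t r. s *s w1 + t *s w2 + r *s w3 = 0 \<Longrightarrow> s = 0 \<and> t = 0 \<and> r = 0"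
  shows "real (card {z. B z w1 = a1 \<and> B z w2 = a2 \<and> B z w3 = a3}) = real CARD('a) ^ (2 * n - 3)"
proof -
  have ind12: "s' = 0 \<and> t' = 0" if "s' *s (w1 + s *s w3) + t' *s w2 = 0" for s s' t'
    using ind[of s' t' "s' * s"] that by (simp add: vector_add_ldistrib vector_smult_assoc algebra_simps)
  have L2: "real (card {z. B z (w1 + s *s w3) = b1 \<and> B z w2 = b2}) = real CARD('a) ^ (2 * n - 2)" for s b1 b2
    using ind12 by (rule card_hyperplanes_2)
  have ind32: "s = 0 \<and> t = 0" if "s *s w3 + t *s w2 = 0" for s t
    using ind[of 0 t s] that by (simp add: algebra_simps)
  have w2: "w2 \<noteq> 0" using ind[of 0 1 0] by auto
  let ?Z = "{z. B z w2 = a2}"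
  have "(\<Sum>s\<in>UNIV. real (card {z \<in> ?Z. (B z w1 - a1) + s * (B z w3 - a3) = 0})) =
      real CARD('a) * real (card {z \<in> ?Z. B z w1 = a1 \<and> B z w3 = a3}) + real (card {z \<in> ?Z. B z w3 \<noteq> a3})"
    using arg_cong[OF sum_card_affine_pencil[of ?Z "\<lambda>z. B z w1 - a1" "\<lambda>z. B z w3 - a3"], of real] by simp
  moreover have "{z \<in> ?Z. (B z w1 - a1) + s * (B z w3 - a3) = 0} =
      {z. B z (w1 + s *s w3) = a1 + s * a3 \<and> B z w2 = a2}" for s
    by (auto simp: B_add_right B_scale_right algebra_simps)
  moreover have "real (card {z \<in> ?Z. B z w3 \<noteq> a3}) = real CARD('a) ^ (2 * n - 1) - real CARD('a) ^ (2 * n - 2)"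
  proof -
    have "{z \<in> ?Z. B z w3 \<noteq> a3} = ?Z - {z. B z w3 = a3 \<and> B z w2 = a2}" by auto
    moreover have "card (?Z - {z. B z w3 = a3 \<and> B z w2 = a2}) = card ?Z - card {z. B z w3 = a3 \<and> B z w2 = a2}"
      by (rule card_Diff_subset) auto
    moreover have "card {z. B z w3 = a3 \<and> B z w2 = a2} \<le> card ?Z" by (rule card_mono) auto
    ultimately show ?thesis
      using card_hyperplanes_1[OF w2] card_hyperplanes_2[OF ind32] by (simp add: of_nat_diff)
  qed
  moreover have "{z \<in> ?Z. B z w1 = a1 \<and> B z w3 = a3} = {z. B z w1 = a1 \<and> B z w2 = a2 \<and> B z w3 = a3}" by auto
  ultimately have "real CARD('a) * real CARD('a) ^ (2 * n - 2) =
      real CARD('a) * real (card {z. B z w1 = a1 \<and> B z w2 = a2 \<and> B z w3 = a3})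
      + (real CARD('a) ^ (2 * n - 1) - real CARD('a) ^ (2 * n - 2))"
    by (simp add: L2)
  moreover obtain k where "n = Suc (Suc k)" using n by (intro that[of "n - 2"]) simp
  ultimately have "real CARD('a) * real CARD('a) ^ (2 * n - 3) =
      real CARD('a) * real (card {z. B z w1 = a1 \<and> B z w2 = a2 \<and> B z w3 = a3})"
    by (simp add: algebra_simps numeral_eq_Suc)
  then show ?thesis using q_ge_2 by simp
qed

section \<open>Affine sections of the quadric\<close>

text \<open>Completing the square: \<open>Q (z + w) = Q z + B z w + Q w\<close>, so translation by
  \<open>w\<close> gives a level set.\<close>

lemma card_section_0:
  "real (card {z. Q z + B z w = a}) =
     real CARD('a) ^ (2 * n - 1) + real CARD('a) ^ (n - 1) - (if Q w + a = 0 then real CARD('a) ^ n else 0)"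
proof -
  have "bij_betw (\<lambda>z. z + w) {z. Q z + B z w = a} {z. Q z = Q w + a}"
    by (rule bij_betwI[where g = "\<lambda>z. z - w"])
      (auto simp: Q_add Q_diff B_diff B_self algebra_simps)
  from bij_betw_same_card[OF this] show ?thesis by (simp add: card_level)
qed

text \<open>The term \<open>B z w\<close> is carried along because adding \<open>s\<close> times the
  constraint only changes \<open>w\<close> to \<open>w + s *s w1\<close> and \<open>a\<close> to
  \<open>a + s * a1\<close>. The defect q^n of \<open>card_section_0\<close> occurs once for each
  root \<open>s\<close>.\<close>

lemma card_section_1:
  assumes w1: "w1 \<noteq> 0"
  shows "real (card {z. Q z + B z w = a \<and> B z w1 = a1}) =
    real CARD('a) ^ (2 * n - 2) + real CARD('a) ^ (n - 1)
    - real CARD('a) ^ (n - 1) * real (card {s. Q (w + s *s w1) + (a + s * a1) = 0})"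
    (is "_ = _ + _ - _ * ?M")
proof -
  have "(\<Sum>s\<in>UNIV. real (card {z. (Q z + B z w - a) + s * (B z w1 - a1) = 0})) =
      real CARD('a) * real (card {z. Q z + B z w = a \<and> B z w1 = a1}) + real (card {z. B z w1 \<noteq> a1})"
    using arg_cong[OF sum_card_affine_pencil[of UNIV "\<lambda>z. Q z + B z w - a" "\<lambda>z. B z w1 - a1"], of real] by simp
  moreover have "{z. (Q z + B z w - a) + s * (B z w1 - a1) = 0} = {z. Q z + B z (w + s *s w1) = a + s * a1}" for s
    by (auto simp: B_add_right B_scale_right algebra_simps)
  moreover have "real (card {z. B z w1 \<noteq> a1}) = real CARD('a) ^ (2 * n) - real CARD('a) ^ (2 * n - 1)"
  proof -
    have "{z. B z w1 \<noteq> a1} = UNIV - {z. B z w1 = a1}" by auto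
    then have "real (card {z. B z w1 \<noteq> a1}) = real CARD('a ^ 'd) - real (card {z. B z w1 = a1})"
      by (simp only: card_Diff_subset finite subset_UNIV of_nat_diff card_mono)
    then show ?thesis using w1 by (simp add: card_hyperplanes_1 dim_d)
  qed
  moreover have "(\<Sum>s\<in>UNIV. if Q (w + s *s w1) + (a + s * a1) = 0 then real CARD('a) ^ n else 0)
      = real CARD('a) ^ n * ?M"
    by (simp add: sum.inter_filter[symmetric])
  ultimately have "real CARD('a) * (real CARD('a) ^ (2 * n - 1) + real CARD('a) ^ (n - 1)) - real CARD('a) ^ n * ?M
    = real CARD('a) * real (card {z. Q z + B z w = a \<and> B z w1 = a1})
      + (real CARD('a) ^ (2 * n) - real CARD('a) ^ (2 * n - 1))"
    by (simp add: card_section_0 sum_subtractf)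
  moreover obtain k where "n = Suc k" using n by (cases n) auto
  ultimately have "real CARD('a) * (real CARD('a) ^ (2 * n - 2) + real CARD('a) ^ (n - 1)
      - real CARD('a) ^ (n - 1) * ?M) = real CARD('a) * real (card {z. Q z + B z w = a \<and> B z w1 = a1})"
    by (simp add: algebra_simps)
  then show ?thesis using q_ge_2 by simp
qed

text \<open>The first constraint stays in the ambient set \<open>?Z\<close> while the pencil runs
  over the second, so the roots are now counted in two parameters.\<close>

lemma card_section_2:
  assumes ind: "\<And>s t. s *s w1 + t *s w2 = 0 \<Longrightarrow> s = 0 \<and> t = 0"
  shows "real (card {z. Q z + B z w = a \<and> B z w1 = a1 \<and> B z w2 = a2}) =
    real CARD('a) ^ (2 * n - 3) + real CARD('a) ^ (n - 1) - real CARD('a) ^ (n - 2) *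
      (\<Sum>t\<in>UNIV. real (card {s. Q (w + t *s w2 + s *s w1) + (a + t * a2 + s * a1) = 0}))"
    (is "real (card ?C) = _ + _ - _ * ?M")
proof -
  have w1: "w1 \<noteq> 0" using ind[of 1 0] by auto
  let ?Z = "{z. B z w1 = a1}"
  have "(\<Sum>t\<in>UNIV. real (card {z \<in> ?Z. (Q z + B z w - a) + t * (B z w2 - a2) = 0})) =
      real CARD('a) * real (card {z \<in> ?Z. Q z + B z w = a \<and> B z w2 = a2}) + real (card {z \<in> ?Z. B z w2 \<noteq> a2})"
    using arg_cong[OF sum_card_affine_pencil[of ?Z "\<lambda>z. Q z + B z w - a" "\<lambda>z. B z w2 - a2"], of real] by simp
  moreover have "{z \<in> ?Z. (Q z + B z w - a) + t * (B z w2 - a2) = 0} =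
      {z. Q z + B z (w + t *s w2) = a + t * a2 \<and> B z w1 = a1}" for t
    by (auto simp: B_add_right B_scale_right algebra_simps)
  moreover have "real (card {z \<in> ?Z. B z w2 \<noteq> a2}) = real CARD('a) ^ (2 * n - 1) - real CARD('a) ^ (2 * n - 2)"
  proof -
    have "{z \<in> ?Z. B z w2 \<noteq> a2} = ?Z - {z. B z w1 = a1 \<and> B z w2 = a2}" by auto
    moreover have "card (?Z - {z. B z w1 = a1 \<and> B z w2 = a2}) = card ?Z - card {z. B z w1 = a1 \<and> B z w2 = a2}"
      by (rule card_Diff_subset) auto
    moreover have "card {z. B z w1 = a1 \<and> B z w2 = a2} \<le> card ?Z" by (rule card_mono) auto
    ultimately show ?thesis
      using card_hyperplanes_1[OF w1] card_hyperplanes_2[OF ind] by (simp add: of_nat_diff)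
  qed
  moreover have "{z \<in> ?Z. Q z + B z w = a \<and> B z w2 = a2} = ?C" by auto
  ultimately have "real CARD('a) * (real CARD('a) ^ (2 * n - 2) + real CARD('a) ^ (n - 1)) - real CARD('a) ^ (n - 1) * ?M
    = real CARD('a) * real (card ?C) + (real CARD('a) ^ (2 * n - 1) - real CARD('a) ^ (2 * n - 2))"
    by (simp add: card_section_1[OF w1] sum_subtractf sum_distrib_left)
  moreover obtain k where "n = Suc (Suc k)" using n by (intro that[of "n - 2"]) simp
  ultimately have "real CARD('a) * (real CARD('a) ^ (2 * n - 3) + real CARD('a) ^ (n - 1)
      - real CARD('a) ^ (n - 2) * ?M) = real CARD('a) * real (card ?C)"
    by (simp add: algebra_simps numeral_eq_Suc)
  then show ?thesis using q_ge_2 by simp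
qed

lemma card_section_3:
  assumes ind: "\<And>s t r. s *s w1 + t *s w2 + r *s w3 = 0 \<Longrightarrow> s = 0 \<and> t = 0 \<and> r = 0"
  shows "real (card {z. Q z + B z w = a \<and> B z w1 = a1 \<and> B z w2 = a2 \<and> B z w3 = a3}) =
    real CARD('a) ^ (2 * n - 4) + real CARD('a) ^ (n - 1) - real CARD('a) ^ (n - 3) *
      (\<Sum>r\<in>UNIV. \<Sum>t\<in>UNIV. real (card {s. Q (w + r *s w3 + t *s w2 + s *s w1)
        + (a + r * a3 + t * a2 + s * a1) = 0}))"
    (is "real (card ?C) = _ + _ - _ * ?M")
proof -
  have ind12: "s = 0 \<and> t = 0" if "s *s w1 + t *s w2 = 0" for s t
    using ind[of s t 0] that by simp
  let ?Z = "{z. B z w1 = a1 \<and> B z w2 = a2}"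
  have "(\<Sum>r\<in>UNIV. real (card {z \<in> ?Z. (Q z + B z w - a) + r * (B z w3 - a3) = 0})) =
      real CARD('a) * real (card {z \<in> ?Z. Q z + B z w = a \<and> B z w3 = a3}) + real (card {z \<in> ?Z. B z w3 \<noteq> a3})"
    using arg_cong[OF sum_card_affine_pencil[of ?Z "\<lambda>z. Q z + B z w - a" "\<lambda>z. B z w3 - a3"], of real] by simp
  moreover have "{z \<in> ?Z. (Q z + B z w - a) + r * (B z w3 - a3) = 0} =
      {z. Q z + B z (w + r *s w3) = a + r * a3 \<and> B z w1 = a1 \<and> B z w2 = a2}" for r
    by (auto simp: B_add_right B_scale_right algebra_simps)
  moreover have "real (card {z \<in> ?Z. B z w3 \<noteq> a3}) = real CARD('a) ^ (2 * n - 2) - real CARD('a) ^ (2 * n - 3)"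
  proof -
    have "{z \<in> ?Z. B z w3 \<noteq> a3} = ?Z - {z. B z w1 = a1 \<and> B z w2 = a2 \<and> B z w3 = a3}" by auto
    moreover have "card (?Z - {z. B z w1 = a1 \<and> B z w2 = a2 \<and> B z w3 = a3})
        = card ?Z - card {z. B z w1 = a1 \<and> B z w2 = a2 \<and> B z w3 = a3}"
      by (rule card_Diff_subset) auto
    moreover have "card {z. B z w1 = a1 \<and> B z w2 = a2 \<and> B z w3 = a3} \<le> card ?Z" by (rule card_mono) auto
    ultimately show ?thesis
      using card_hyperplanes_2[OF ind12] card_hyperplanes_3[OF ind] by (simp add: of_nat_diff)
  qed
  moreover have "{z \<in> ?Z. Q z + B z w = a \<and> B z w3 = a3} = ?C" by auto
  ultimately have "real CARD('a) * (real CARD('a) ^ (2 * n - 3) + real CARD('a) ^ (n - 1)) - real CARD('a) ^ (n - 2) * ?M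
    = real CARD('a) * real (card ?C) + (real CARD('a) ^ (2 * n - 2) - real CARD('a) ^ (2 * n - 3))"
    by (simp add: card_section_2[OF ind12] sum_subtractf sum_distrib_left)
  \<comment> \<open>Writing \<open>n\<close> as \<open>k + 3\<close> removes the truncated
    differences in the exponents.\<close>
  moreover obtain k where "n = Suc (Suc (Suc k))" using n by (intro that[of "n - 3"]) simp
  ultimately have "real CARD('a) * (real CARD('a) ^ (2 * n - 4) + real CARD('a) ^ (n - 1)
      - real CARD('a) ^ (n - 3) * ?M) = real CARD('a) * real (card ?C)"
    by (simp add: algebra_simps numeral_eq_Suc)
  then show ?thesis using q_ge_2 by simp
qed

text \<open>By \<open>card_polarity_subspace\<close> the polar space of \<open>H\<close> has q
  vectors, so it is spanned by one vector \<open>p\<close>. If \<open>Q p\<close> were 0, then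
  \<open>B p p = 0\<close> would put \<open>p\<close> into \<open>H\<close>, as a nonzero singular
  vector of its radical.\<close>

lemma pole_exists:
  assumes "hyperplane H" and nondeg: "nondegenerate_on Q H"
  shows "\<exists>p. H = {z. B z p = 0} \<and> polarity Q H = vec.span {p} \<and> Q p \<noteq> 0"
proof -
  have H: "vec.subspace H" and "card H = CARD('a) ^ (2 * n - 1)"
    using assms(1) card_subspace[of H] by (auto simp: hyperplane_def dim_d)
  have pow: "CARD('a) ^ (2 * n) = CARD('a) ^ (2 * n - 1) * CARD('a)"
    using n by (cases n) auto
  have pol: "card (polarity Q H) = CARD('a)"
    using card_polarity_subspace[OF H] q_ge_2 unfolding pow \<open>card H = _\<close> by simp
  have "\<not> polarity Q H \<subseteq> {0}"
  proof
    assume "polarity Q H \<subseteq> {0}"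
    then have "card (polarity Q H) \<le> card {0 :: 'a ^ 'd}" by (intro card_mono) auto
    then show False using pol q_ge_2 by simp
  qed
  then obtain p where p: "p \<in> polarity Q H" "p \<noteq> 0" by auto
  have "card (vec.span {p}) = card (polarity Q H)"
    using card_span_independent[of "{p}"] p pol by simp
  moreover have "vec.span {p} \<subseteq> polarity Q H"
    using p subspace_polarity by (intro vec.span_minimal) auto
  ultimately have span: "polarity Q H = vec.span {p}" by (metis card_subset_eq finite)
  have "H \<subseteq> {z. B z p = 0}" using p(1) by (auto simp: polarity_def B_commute)
  moreover have "card {z. B z p = 0} = card H"
  proof -
    have "real (card {z. B z p = 0}) = real (CARD('a) ^ (2 * n - 1))"
      using card_hyperplanes_1[OF p(2), of 0] by simp
    then show ?thesis unfolding \<open>card H = _\<close> of_nat_eq_iff .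
  qed
  ultimately have H_eq: "H = {z. B z p = 0}" by (intro card_subset_eq) auto
  have "Q p \<noteq> 0"
  proof
    assume "Q p = 0"
    then have "p \<in> H" by (simp add: H_eq B_self)
    then show False
      using nondeg p \<open>Q p = 0\<close> by (auto simp: nondegenerate_on_def polarity_def)
  qed
  with H_eq span show ?thesis by blast
qed

end

section \<open>The scheme on the points off a hyperplane\<close>

locale elliptic_section = elliptic_space Q n for Q :: "'a::{field,finite} ^ 'd::finite \<Rightarrow> 'a" and n :: nat +
  fixes H :: "('a ^ 'd) set" and p :: "'a ^ 'd"
  assumes H_eq: "H = {z. B z p = 0}" and polarity_H: "polarity Q H = vec.span {p}"
    and Q_p: "Q p \<noteq> 0" and q_gt_2: "CARD('a) > 2"
begin

section \<open>Normalised representatives of the points\<close>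

definition S :: "('a ^ 'd) set" where "S = {x. Q x = 0 \<and> B x p = 1}"

definition pt :: "'a ^ 'd \<Rightarrow> ('a ^ 'd) set" where "pt x = vec.span {x}"

text \<open>On \<open>S\<close> this is the negative of the reflection in \<open>p\<close>; the sign
  preserves the normalisation \<open>B x p = 1\<close>.\<close>

definition sg :: "'a ^ 'd \<Rightarrow> 'a ^ 'd" where "sg x = (1 / Q p) *s p - x"

lemma B_sg: "x \<in> S \<Longrightarrow> B x (sg y) = 1 / Q p - B x y"
  by (simp add: sg_def S_def B_diff B_scale_right)

lemma sg_in: "x \<in> S \<Longrightarrow> sg x \<in> S"
  using Q_p by (simp add: S_def sg_def Q_diff B_diff Q_scale B_scale_left B_self B_commute[of p x] power2_eq_square)

lemma sg_sg: "sg (sg x) = x"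
  by (simp add: sg_def)

lemma B_S_self: "x \<in> S \<Longrightarrow> B x x = 0"
  by (simp add: S_def B_self)

lemma sg_neq: "x \<in> S \<Longrightarrow> sg x \<noteq> x"
  using B_sg[of x x] B_S_self[of x] Q_p by auto

lemma S_nonzero: "x \<in> S \<Longrightarrow> x \<noteq> 0"
  by (auto simp: S_def)

lemma mem_pt: "v \<in> pt x \<longleftrightarrow> (\<exists>k. v = k *s x)"
  by (auto simp: pt_def vec.span_singleton)

lemma inj_pt: "inj_on pt S"
proof (rule inj_onI)
  fix x y assume xy: "x \<in> S" "y \<in> S" "pt x = pt y"
  have "x \<in> pt x" by (auto simp: mem_pt intro: exI[of _ 1])
  then obtain k where k: "x = k *s y" using xy by (auto simp: mem_pt)
  then have "B x p = k * B y p" by (simp add: B_scale_left)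
  then have "k = 1" using xy by (simp add: S_def)
  then show "x = y" using k by simp
qed

lemma pt_quadric_point: assumes "Q x = 0" "x \<noteq> 0" shows "pt x \<in> quadric_points Q"
proof -
  have "vec.dim (vec.span {x}) = 1"
    using assms vec.dim_span_eq_card_independent[of "{x}"] by simp
  then show ?thesis
    unfolding quadric_points_def pt_def totally_singular_def
    using assms by (auto simp: vec.span_breakdown_eq Q_scale)
qed

lemma Omega_eq: "Omega Q H = pt ` S"
proof (intro equalityI subsetI)
  fix X assume "X \<in> Omega Q H"
  then have X: "vec.subspace X" "vec.dim X = 1" "totally_singular Q X" and "\<not> X \<subseteq> H"
    by (auto simp: Omega_def quadric_points_def)
  then obtain v where v: "v \<in> X" "B v p \<noteq> 0" by (auto simp: H_eq)
  define x where "x = (1 / B v p) *s v"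
  have "x \<in> X" using X v by (simp add: x_def vec.subspace_scale)
  moreover have "x \<in> S" using X v by (simp add: x_def S_def totally_singular_def Q_scale B_scale_left)
  ultimately show "X \<in> pt ` S"
    using subspace_dim_1_eq_span[OF X(1,2), of x] S_nonzero by (auto simp: pt_def)
next
  fix X assume "X \<in> pt ` S"
  then obtain x where x: "x \<in> S" "X = pt x" by auto
  have "x \<in> pt x" by (auto simp: mem_pt intro: exI[of _ 1])
  then have "\<not> X \<subseteq> H" using x by (auto simp: H_eq S_def)
  moreover have "X \<in> quadric_points Q"
    unfolding x(2) using x S_nonzero by (intro pt_quadric_point) (auto simp: S_def)
  ultimately show "X \<in> Omega Q H" by (simp add: Omega_def)
qed

lemma span_pt_union: "vec.span (pt x \<union> vec.span {y}) = {a *s x + b *s y | a b. True}"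
proof -
  have "vec.span (pt x \<union> vec.span {y}) = {v + w | v w. v \<in> vec.span {x} \<and> w \<in> vec.span {y}}"
    by (simp only: pt_def vec.span_Un vec.span_span)
  then show ?thesis by (auto simp: vec.span_singleton)
qed

text \<open>For singular \<open>x\<close> and \<open>y\<close>, \<open>Q (a *s x + b *s y)\<close>
  is \<open>a * b * B x y\<close>.\<close>

lemma adj_pt:
  assumes "x \<in> S" "y \<in> S"
  shows "quadric_adj Q (pt x) (pt y) \<longleftrightarrow> x \<noteq> y \<and> B x y = 0"
proof -
  have "totally_singular Q (vec.span (pt x \<union> vec.span {y})) \<longleftrightarrow> B x y = 0"
  proof
    assume "totally_singular Q (vec.span (pt x \<union> vec.span {y}))"
    moreover have "1 *s x + 1 *s y \<in> vec.span (pt x \<union> vec.span {y})"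
      unfolding span_pt_union by blast
    ultimately have "Q (x + y) = 0" by (simp add: totally_singular_def)
    then show "B x y = 0" using assms by (simp add: Q_add S_def)
  next
    assume "B x y = 0"
    then show "totally_singular Q (vec.span (pt x \<union> vec.span {y}))"
      unfolding span_pt_union totally_singular_def using assms
      by (auto simp: Q_add Q_scale B_scale_left B_scale_right S_def)
  qed
  moreover have "pt x = pt y \<longleftrightarrow> x = y" using inj_pt assms by (auto dest: inj_onD)
  ultimately show ?thesis unfolding quadric_adj_def by (metis pt_def)
qed

lemma sigma_pt:
  assumes x: "x \<in> S"
  shows "sigma_inv Q H (pt x) = pt (sg x)"
  unfolding sigma_inv_def polarity_H
proof (rule the_equality)
  have "pt (sg x) \<in> quadric_points Q"
    using sg_in[OF x] S_nonzero by (intro pt_quadric_point) (auto simp: S_def)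
  moreover have "pt (sg x) \<subseteq> vec.span (pt x \<union> vec.span {p})"
  proof
    fix v assume "v \<in> pt (sg x)"
    then obtain k where "v = k *s sg x" by (auto simp: mem_pt)
    then have "v = (- k) *s x + (k / Q p) *s p"
      by (simp add: sg_def vector_ssub_ldistrib vector_smult_assoc)
    then show "v \<in> vec.span (pt x \<union> vec.span {p})" unfolding span_pt_union by blast
  qed
  moreover have "pt (sg x) \<noteq> pt x"
    using inj_pt x sg_in[OF x] sg_neq[OF x] by (auto dest: inj_onD)
  ultimately show "pt (sg x) \<in> quadric_points Q \<and> pt (sg x) \<subseteq> vec.span (pt x \<union> vec.span {p}) \<and> pt (sg x) \<noteq> pt x"
    by blast
next
  fix P assume P: "P \<in> quadric_points Q \<and> P \<subseteq> vec.span (pt x \<union> vec.span {p}) \<and> P \<noteq> pt x"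
  then have sub: "vec.subspace P" "vec.dim P = 1" and ts: "totally_singular Q P"
    by (auto simp: quadric_points_def)
  have "\<not> P \<subseteq> {0}" using sub(2) vec.dim_subset[of P "{0}"] by auto
  then obtain v where v: "v \<in> P" "v \<noteq> 0" by auto
  have Pv: "P = vec.span {v}" using subspace_dim_1_eq_span[OF sub v] .
  obtain a b where ab: "v = a *s x + b *s p" using P v unfolding span_pt_union by blast
  \<comment> \<open>The form factors on the line, so besides the point with \<open>b = 0\<close>
    there is a single further one.\<close>
  have "Q v = b * (a + b * Q p)"
    using x unfolding ab by (simp add: Q_add Q_scale B_scale_left B_scale_right S_def algebra_simps power2_eq_square)
  then have "b = 0 \<or> a = - (b * Q p)" using ts v by (auto simp: totally_singular_def eq_neg_iff_add_eq_0)
  moreover have "b \<noteq> 0"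
  proof
    assume "b = 0"
    then have "v = a *s x" "a \<noteq> 0" using ab v by auto
    then have "P = pt x" unfolding Pv pt_def by (simp add: span_singleton_scale)
    then show False using P by blast
  qed
  ultimately have "v = (b * Q p) *s sg x"
    unfolding ab sg_def using Q_p by (simp add: vector_ssub_ldistrib vector_smult_assoc)
  then show "P = pt (sg x)"
    unfolding Pv pt_def using \<open>b \<noteq> 0\<close> Q_p span_singleton_scale[of "b * Q p" "sg x"] by simp
qed

lemma card_Omega_filter: "card {Z \<in> Omega Q H. P Z} = card {z \<in> S. P (pt z)}"
proof -
  have "{Z \<in> Omega Q H. P Z} = pt ` {z \<in> S. P (pt z)}" by (auto simp: Omega_eq)
  moreover have "inj_on pt {z \<in> S. P (pt z)}" using inj_pt by (rule inj_on_subset) auto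
  ultimately show ?thesis by (simp add: card_image)
qed

section \<open>Counting representatives by their polar products\<close>

lemma independent_2:
  assumes x: "x \<in> S" and eq: "s *s x + t *s p = 0"
  shows "s = 0 \<and> t = 0"
proof -
  have "B x (s *s x + t *s p) = 0" "B (s *s x + t *s p) p = 0" by (simp_all only: eq B_zero)
  then show ?thesis using x by (simp add: B_add_left B_add_right B_scale_left B_scale_right B_S_self S_def B_self)
qed

text \<open>Both \<open>r *s y + s *s p\<close> and \<open>t *s x + s *s p\<close> are multiples of
  singular vectors, hence singular. If \<open>s\<close> were nonzero, this would force
  \<open>r = t = - (s * Q p)\<close> and so \<open>x = sg y\<close>. With \<open>s = 0\<close>,
  pairing with \<open>p\<close> leaves a multiple of \<open>x - y\<close>.\<close>

lemma independent_3:
  assumes xy: "x \<in> S" "y \<in> S" "x \<noteq> y" "x \<noteq> sg y" and eq: "r *s y + t *s x + s *s p = 0"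
  shows "r = 0 \<and> t = 0 \<and> s = 0"
proof -
  have "r *s y + s *s p = (- t) *s x" "t *s x + s *s p = (- r) *s y"
    using eq by (simp_all add: eq_neg_iff_add_eq_0 algebra_simps)
  then have "Q (r *s y + s *s p) = 0" "Q (t *s x + s *s p) = 0"
    using xy by (simp_all only: Q_scale) (simp_all add: S_def)
  then have "s * (s * Q p + r) = 0" "s * (s * Q p + t) = 0"
    using xy by (simp_all add: Q_add Q_scale B_scale_left B_scale_right S_def B_commute[of p x] B_commute[of p y]
        algebra_simps power2_eq_square)
  then have "s = 0 \<or> (r = - (s * Q p) \<and> t = - (s * Q p))"
    by (auto simp: eq_neg_iff_add_eq_0 add.commute)
  moreover have "\<not> (s \<noteq> 0 \<and> r = - (s * Q p) \<and> t = - (s * Q p))"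
  proof
    assume s: "s \<noteq> 0 \<and> r = - (s * Q p) \<and> t = - (s * Q p)"
    then have "(s * Q p) *s (sg y - x) = 0"
      using eq Q_p by (simp add: sg_def vector_ssub_ldistrib vector_smult_assoc algebra_simps)
    then show False using s xy Q_p by simp
  qed
  ultimately have "s = 0" by auto
  then have "r *s y + t *s x = 0" using eq by simp
  then have "B (r *s y + t *s x) p = 0" by simp
  then have rt: "r = - t" using xy by (simp add: B_add_left B_scale_left S_def eq_neg_iff_add_eq_0)
  then have "t *s (x - y) = 0" using \<open>r *s y + t *s x = 0\<close> by (simp add: vector_ssub_ldistrib)
  then show ?thesis using xy rt \<open>s = 0\<close> by simp
qed

text \<open>In \<open>card_section_1\<close> with \<open>w = 0\<close> the polynomial is
  \<open>s * (s * Q p + 1)\<close>, which has two roots.\<close>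

lemma card_S: "real (card S) = real CARD('a) ^ (2 * n - 2) - real CARD('a) ^ (n - 1)"
proof -
  have "Q (0 + s *s p) + (0 + s * 1) = s * (s * Q p + 1)" for s
    by (simp add: Q_scale power2_eq_square algebra_simps)
  moreover have "s * Q p + 1 = 0 \<longleftrightarrow> s = - 1 / Q p" for s
    unfolding eq_divide_eq eq_neg_iff_add_eq_0 using Q_p by simp
  ultimately have "{s. Q (0 + s *s p) + (0 + s * 1) = 0} = {0, - 1 / Q p}"
    by (simp only: mult_eq_0_iff) auto
  moreover have "S = {z. Q z + B z 0 = 0 \<and> B z p = 1}" by (simp add: S_def)
  moreover have "p \<noteq> 0" using Q_p by auto
  ultimately show ?thesis using card_section_1[of p 0 0 1] Q_p by simp
qed

text \<open>Since \<open>Q x = 0\<close>, the polynomial is affine in the coefficient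
  \<open>s\<close> of \<open>x\<close>, with slope \<open>t\<close>. It has one root for each
  \<open>t \<noteq> 0\<close> and q roots for \<open>t = 0\<close>, in total 2q - 1.\<close>

lemma card_S_1:
  assumes x: "x \<in> S"
  shows "real (card {z \<in> S. B z x = 0}) =
    real CARD('a) ^ (2 * n - 3) + real CARD('a) ^ (n - 1) - real CARD('a) ^ (n - 2) * (2 * real CARD('a) - 1)"
proof -
  have "card {s. Q (0 + t *s p + s *s x) + (0 + t * 1 + s * 0) = 0} = (if t \<noteq> 0 then 1 else CARD('a))" for t
  proof -
    have expand: "Q (0 + t *s p + s *s x) + (0 + t * 1 + s * 0) = t * s + (t\<^sup>2 * Q p + t)" for s
      using x by (simp add: Q_add Q_scale B_scale_left B_scale_right S_def B_commute[of p x])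
    show ?thesis unfolding expand card_roots_affine by auto
  qed
  then have "(\<Sum>t\<in>UNIV. real (card {s. Q (0 + t *s p + s *s x) + (0 + t * 1 + s * 0) = 0}))
      = (\<Sum>t\<in>(UNIV :: 'a set). if t \<noteq> 0 then 1 else real CARD('a))"
    by (intro sum.cong) auto
  also have "\<dots> = 2 * real CARD('a) - 1"
    using q_ge_2 by (simp add: sum.remove[of UNIV 0] card_Diff_subset of_nat_diff)
  finally have M: "(\<Sum>t\<in>UNIV. real (card {s. Q (0 + t *s p + s *s x) + (0 + t * 1 + s * 0) = 0}))
      = 2 * real CARD('a) - 1" .
  have "{z \<in> S. B z x = 0} = {z. Q z + B z 0 = 0 \<and> B z x = 0 \<and> B z p = 1}" by (auto simp: S_def)
  then show ?thesis using card_section_2[where ?w1.0 = x and ?w2.0 = p and w = 0 and a = 0 and ?a1.0 = 0 and ?a2.0 = 1, OF independent_2[OF x]] M by simp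
qed

text \<open>Since \<open>Q y = 0\<close>, the polynomial is affine in the coefficient
  \<open>s\<close> of \<open>y\<close>, with slope \<open>r + t * B x y\<close>. The three cases of
  the result come from the parameters where this slope vanishes.\<close>

lemma card_S_2:
  assumes xy: "x \<in> S" "y \<in> S" "x \<noteq> y" "x \<noteq> sg y"
  shows "real (card {z \<in> S. B z x = 0 \<and> B z y = 0}) =
    real CARD('a) ^ (2 * n - 4) + real CARD('a) ^ (n - 1) - real CARD('a) ^ (n - 3) *
      (real CARD('a) * (real CARD('a) - 1) + real CARD('a) *
        (if B x y = 0 then real CARD('a) else if B x y = 1 / Q p then 1 else 2))"
proof -
  let ?b = "B x y" and ?q = "real CARD('a)"
  let ?f = "\<lambda>r t. Q p * r\<^sup>2 + r * t + r"
  have inner: "real (card {s. Q (0 + r *s p + t *s x + s *s y) + (0 + r * 1 + t * 0 + s * 0) = 0}) =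
      (if r + t * ?b \<noteq> 0 then 1 else if ?f r t = 0 then ?q else 0)" for r t
  proof -
    have expand: "Q (0 + r *s p + t *s x + s *s y) + (0 + r * 1 + t * 0 + s * 0) = (r + t * ?b) * s + ?f r t" for s
      using xy by (simp add: Q_add Q_scale B_add_left B_scale_left B_scale_right S_def
          B_commute[of p x] B_commute[of p y] distrib_left distrib_right mult.commute mult.left_commute)
    show ?thesis unfolding expand card_roots_affine by simp
  qed
  have middle: "(\<Sum>r\<in>UNIV. if r + t * ?b \<noteq> 0 then 1 else if ?f r t = 0 then ?q else 0) =
      ?q - 1 + (if t * ?b * (t * (?b * Q p - 1) - 1) = 0 then ?q else 0)" for t
  proof -
    \<comment> \<open>For given \<open>t\<close> the slope vanishes only at
      \<open>r = - (t * ?b)\<close>, and there the constant term factors.\<close>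
    have "?f (- (t * ?b)) t = t * ?b * (t * (?b * Q p - 1) - 1)"
      by (simp add: algebra_simps power2_eq_square)
    moreover have "(\<Sum>r\<in>UNIV - {- (t * ?b)}. if r + t * ?b \<noteq> 0 then 1 else if ?f r t = 0 then ?q else 0)
        = (\<Sum>r\<in>UNIV - {- (t * ?b)}. 1)"
      by (intro sum.cong) (auto simp: eq_neg_iff_add_eq_0)
    ultimately show ?thesis
      using q_ge_2 by (simp add: sum.remove[of UNIV "- (t * ?b)"] card_Diff_subset of_nat_diff del: mult_eq_0_iff)
  qed
  have roots: "card {t. t * ?b * (t * (?b * Q p - 1) - 1) = 0} =
      (if ?b = 0 then CARD('a) else if ?b = 1 / Q p then 1 else 2)"
  proof -
    consider "?b = 0" | "?b \<noteq> 0" "?b = 1 / Q p" | "?b \<noteq> 0" "?b \<noteq> 1 / Q p" by blast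
    then show ?thesis
    proof cases
      case 2
      then have "{t. t * ?b * (t * (?b * Q p - 1) - 1) = 0} = {0}" using Q_p by auto
      then show ?thesis using 2 by simp
    next
      case 3
      define d where "d = ?b * Q p - 1"
      have "d \<noteq> 0" using 3 Q_p by (auto simp: d_def eq_divide_eq)
      then have "{t. t * ?b * (t * d - 1) = 0} = {0, 1 / d}" "1 / d \<noteq> 0"
        using 3 by (auto simp: eq_divide_eq)
      then show ?thesis using 3 unfolding d_def[symmetric] by simp
    qed simp
  qed
  have "(\<Sum>r\<in>UNIV. \<Sum>t\<in>UNIV. real (card {s. Q (0 + r *s p + t *s x + s *s y) + (0 + r * 1 + t * 0 + s * 0) = 0}))
    = (\<Sum>t\<in>UNIV. \<Sum>r\<in>UNIV. if r + t * ?b \<noteq> 0 then 1 else if ?f r t = 0 then ?q else 0)"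
    unfolding inner by (rule sum.swap)
  also have "\<dots> = ?q * (?q - 1) + (\<Sum>t\<in>UNIV. if t * ?b * (t * (?b * Q p - 1) - 1) = 0 then ?q else 0)"
    unfolding middle by (simp add: sum.distrib del: mult_eq_0_iff)
  also have "(\<Sum>t\<in>UNIV. if t * ?b * (t * (?b * Q p - 1) - 1) = 0 then ?q else 0)
      = ?q * real (card {t. t * ?b * (t * (?b * Q p - 1) - 1) = 0})"
    by (simp add: sum.inter_filter[symmetric] del: mult_eq_0_iff)
  finally have M: "(\<Sum>r\<in>UNIV. \<Sum>t\<in>UNIV. real (card {s. Q (0 + r *s p + t *s x + s *s y) + (0 + r * 1 + t * 0 + s * 0) = 0}))
    = ?q * (?q - 1) + ?q * (if ?b = 0 then ?q else if ?b = 1 / Q p then 1 else 2)"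
    unfolding roots by simp
  have "{z \<in> S. B z x = 0 \<and> B z y = 0} = {z. Q z + B z 0 = 0 \<and> B z y = 0 \<and> B z x = 0 \<and> B z p = 1}"
    by (auto simp: S_def)
  then show ?thesis
    using card_section_3[where ?w1.0 = y and ?w2.0 = x and ?w3.0 = p and w = 0 and a = 0 and ?a1.0 = 0 and ?a2.0 = 0 and ?a3.0 = 1, OF independent_3[OF xy]] unfolding M by simp
qed

lemma antipodal_graph_Omega:
  "antipodal_graph (Omega Q H) (quadric_adj Q) (sigma_inv Q H) (real CARD('a)) (real CARD('a) ^ (n - 2))"
proof
  let ?q = "real CARD('a)" and ?u = "real CARD('a) ^ (n - 2)"
  obtain k where k: "n = Suc (Suc (Suc k))" using n by (intro that[of "n - 3"]) simp
  note transfer = Omega_eq adj_pt sigma_pt sg_in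
  show "?q > 2" using q_gt_2 by simp
  show "?u > 1" using q_gt_2 unfolding k by (intro one_less_power) auto
  show "sigma_inv Q H X \<in> Omega Q H" if "X \<in> Omega Q H" for X
    using that by (auto simp: transfer)
  show "sigma_inv Q H (sigma_inv Q H X) = X" if "X \<in> Omega Q H" for X
    using that by (auto simp: transfer sg_sg)
  show "sigma_inv Q H X \<noteq> X" if "X \<in> Omega Q H" for X
    using that inj_onD[OF inj_pt] sg_neq by (auto simp: transfer) (metis sg_in)
  show "quadric_adj Q Y X" if "X \<in> Omega Q H" "Y \<in> Omega Q H" "quadric_adj Q X Y" for X Y
    using that by (auto simp: transfer B_commute)
  show "\<not> quadric_adj Q X X" for X
    by (simp add: quadric_adj_def)
  show "quadric_adj Q (sigma_inv Q H X) (sigma_inv Q H Y) \<longleftrightarrow> quadric_adj Q X Y"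
    if XY: "X \<in> Omega Q H" "Y \<in> Omega Q H" for X Y
  proof -
    obtain x y where xy: "x \<in> S" "y \<in> S" "X = pt x" "Y = pt y" using XY by (auto simp: Omega_eq)
    have "B (sg x) (sg y) = B x y"
      using B_sg[OF sg_in[OF xy(1)], of y] B_sg[OF xy(2), of x] by (simp add: B_commute)
    moreover have "sg x = sg y \<longleftrightarrow> x = y" by (metis sg_sg)
    ultimately show ?thesis using xy by (simp add: transfer)
  qed
  show "\<not> quadric_adj Q X (sigma_inv Q H Y)"
    if XY: "X \<in> Omega Q H" "Y \<in> Omega Q H" "quadric_adj Q X Y" for X Y
    using XY Q_p by (auto simp: transfer B_sg)
  show "\<not> quadric_adj Q X (sigma_inv Q H X)" if "X \<in> Omega Q H" for X
    using that Q_p by (auto simp: transfer B_sg B_S_self)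
  have card_Omega: "card (Omega Q H) = card S"
    unfolding Omega_eq by (rule card_image[OF inj_pt])
  show "real (card (Omega Q H)) = ?q * ?u * (?q * ?u - 1)"
    unfolding card_Omega card_S k by (simp add: algebra_simps power_add power_mult power2_eq_square)
  show "real (card {Z \<in> Omega Q H. quadric_adj Q X Z}) = (?u - 1) * (?q * ?u + 1)"
    if X: "X \<in> Omega Q H" for X
  proof -
    obtain x where x: "x \<in> S" "X = pt x" using X by (auto simp: Omega_eq)
    have "card {Z \<in> Omega Q H. quadric_adj Q X Z} = card {z \<in> S. quadric_adj Q (pt x) (pt z)}"
      unfolding x(2) by (rule card_Omega_filter)
    \<comment> \<open>\<open>x\<close> satisfies \<open>B x x = 0\<close> but is not its own
      neighbour.\<close>
    also have "{z \<in> S. quadric_adj Q (pt x) (pt z)} = {z \<in> S. B z x = 0} - {x}"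
      using x by (auto simp: adj_pt B_commute)
    also have "card \<dots> = card {z \<in> S. B z x = 0} - 1"
      using x by (simp add: B_S_self)
    finally have "card {Z \<in> Omega Q H. quadric_adj Q X Z} = card {z \<in> S. B z x = 0} - 1" .
    moreover have "x \<in> {z \<in> S. B z x = 0}" using x by (simp add: B_S_self)
    then have "card {z \<in> S. B z x = 0} > 0" by (auto simp: card_gt_0_iff)
    ultimately have "real (card {Z \<in> Omega Q H. quadric_adj Q X Z}) = real (card {z \<in> S. B z x = 0}) - 1"
      by simp
    then show ?thesis
      unfolding card_S_1[OF x(1)] k by (simp add: algebra_simps power_add power_mult power2_eq_square)
  qed
  show "real (card {Z \<in> Omega Q H. quadric_adj Q X Z \<and> quadric_adj Q Z Y}) =
      (if quadric_adj Q X Y then ?u\<^sup>2 - ?q * ?u + ?u - 2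
       else if quadric_adj Q X (sigma_inv Q H Y) then ?u\<^sup>2 else ?u\<^sup>2 - ?u)"
    if XY: "X \<in> Omega Q H" "Y \<in> Omega Q H" "X \<noteq> Y" "X \<noteq> sigma_inv Q H Y" for X Y
  proof -
    obtain x y where xy: "x \<in> S" "y \<in> S" "X = pt x" "Y = pt y" using XY by (auto simp: Omega_eq)
    then have ne: "x \<noteq> y" "x \<noteq> sg y" using XY by (auto simp: sigma_pt)
    have adj: "quadric_adj Q X Y \<longleftrightarrow> B x y = 0" "quadric_adj Q X (sigma_inv Q H Y) \<longleftrightarrow> B x y = 1 / Q p"
      using xy ne by (auto simp: adj_pt sigma_pt sg_in B_sg)
    let ?N = "{z \<in> S. B z x = 0 \<and> B z y = 0}"
    have "card {Z \<in> Omega Q H. quadric_adj Q X Z \<and> quadric_adj Q Z Y}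
        = card {z \<in> S. quadric_adj Q (pt x) (pt z) \<and> quadric_adj Q (pt z) (pt y)}"
      unfolding xy(3,4) by (rule card_Omega_filter)
    also have "{z \<in> S. quadric_adj Q (pt x) (pt z) \<and> quadric_adj Q (pt z) (pt y)} = ?N - {x, y}"
      using xy by (auto simp: adj_pt B_commute)
    finally have C: "card {Z \<in> Omega Q H. quadric_adj Q X Z \<and> quadric_adj Q Z Y} = card (?N - {x, y})" .
    \<comment> \<open>If \<open>B x y = 0\<close>, both \<open>x\<close> and \<open>y\<close> lie in
      \<open>?N\<close> and have to be discarded; otherwise neither lies in it.\<close>
    have N: "real (card (?N - {x, y})) = real (card ?N) - (if B x y = 0 then 2 else 0)"
    proof (cases "B x y = 0")
      case True
      then have sub: "{x, y} \<subseteq> ?N" using xy by (auto simp: B_S_self B_commute)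
      then have "card {x, y} \<le> card ?N" by (intro card_mono) auto
      then show ?thesis using True ne card_Diff_subset[OF _ sub] by (simp add: of_nat_diff)
    next
      case False
      then have "?N - {x, y} = ?N" using xy by (auto simp: B_commute)
      then show ?thesis using False by simp
    qed
    \<comment> \<open>In terms of \<open>?u\<close> the size of \<open>?N\<close> is
      \<open>u\<^sup>2 + u - m * u\<close> with \<open>m\<close> equal to q, 1 or 2.\<close>
    show ?thesis
      unfolding C N adj card_S_2[OF xy(1,2) ne] k
      using Q_p by (simp add: algebra_simps power_add power_mult power2_eq_square)
  qed
qed

end

section \<open>The scheme and its matrix of eigenvalues\<close>

theorem theorem7p3:
  fixes Q :: "'a::{field,finite} ^ 'd::finite \<Rightarrow> 'a"
    and H :: "('a ^ 'd) set"
    and q n :: nat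
  assumes "CARD('a) = q" and "q > 2" and "n \<ge> 3"
    and "elliptic_form n Q"
    and "hyperplane H" and "nondegenerate_on Q H"
  shows "association_scheme (Omega Q H) 4 (Omega_rel Q H) \<and>
    (\<exists>E. bij_betw E {..4} (minimal_idempotents (bose_mesner 4 (Omega_rel Q H))) \<and>
       E 0 = (1 / real (card (Omega Q H))) *\<^sub>R all_ones (Omega Q H) \<and>
       eigenvalue_matrix 4 (Omega_rel Q H) E (\<lambda>i l.
         [[1, (real q ^ (n-2) - 1) * (real q ^ (n-1) + 1),
              real q ^ (n-2) * (real q - 2) * (real q ^ (n-1) + 1),
              (real q ^ (n-2) - 1) * (real q ^ (n-1) + 1), 1],
          [1, real q ^ (n-1) + 1, 0, - (real q ^ (n-1) + 1), - 1],
          [1, real q ^ (n-2) - 1, - (2 * real q ^ (n-2)), real q ^ (n-2) - 1, 1],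
          [1, - (real q ^ (n-2) - 1), 0, real q ^ (n-2) - 1, - 1],
          [1, - (real q ^ (n-2) * (real q - 2)) - 1, 2 * real q ^ (n-2) * (real q - 2),
              - (real q ^ (n-2) * (real q - 2)) - 1, 1]] ! i ! l))"
proof -
  interpret elliptic_space Q n
    using assms by unfold_locales (auto simp: elliptic_form_def)
  obtain p where p: "H = {z. B z p = 0}" "polarity Q H = vec.span {p}" "Q p \<noteq> 0"
    using pole_exists[OF assms(5,6)] by blast
  interpret elliptic_section Q n H p
    using p assms by unfold_locales auto
  interpret antipodal_graph "Omega Q H" "quadric_adj Q" "sigma_inv Q H" "real q" "real q ^ (n - 2)"
    using antipodal_graph_Omega assms(1) by simp
  have rel: "Omega_rel Q H = antipodal_rel (Omega Q H) (quadric_adj Q) (sigma_inv Q H)"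
    by (simp add: fun_eq_iff Omega_rel_def antipodal_rel_def)
  \<comment> \<open>The abstract graph has \<open>q * u\<close> where the matrix of eigenvalues has
    q^(n-1).\<close>
  have pow: "real q * real q ^ (n - 2) = real q ^ (n - 1)"
    unfolding power_Suc[symmetric] using assms(3) by (intro arg_cong[of _ _ "(^) (real q)"]) simp
  show ?thesis
    using scheme idempotents unfolding rel eigval_def pow by blast
qed

end
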